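(* Let $(M,\circ,g,e,E)$ be a homogeneous (pseudo-)Riemannian F-manifold with Killing unit vector field, and let $\nabla$ be its associated flat connection. Let $\overline X$ be a Legendre vector field (with respect to $\nabla$) that is flat, i.e. $\nabla\overline X=0$, and homogeneous, i.e. $\mathcal L_E\overline X=\overline d\cdot\overline X$ for some constant $\overline d$. Then $(M,\circ,\overline g,e,E)$, where $\overline g(Y,Z):=g(\overline X\circ Y,\overline X\circ Z)$ for all vector fields $Y,Z$, is a homogeneous (pseudo-)Riemannian F-manifold with Killing unit vector field.
   Context: $M$ is a smooth manifold; "vector field" means smooth local vector field; metrics are pseudo-Riemannian (nondegenerate, symmetric). $d\theta(X,Y)=X(\theta(Y))-Y(\theta(X))-\theta([X,Y])$. The Riemann tensor of a connection $\nabla$ is $R(X,Y)Z=\nabla_X\nabla_YZ-\nabla_Y\nabla_XZ-\nabla_{[X,Y]}Z$. $\mathcal L$ denotes the Lie derivative and $\circ$ is viewed as a $(1,2)$ tensor. F-manifold: a triple $(M,\circ,e)$ where $\circ$ is a commutative associative $C^\infty$-bilinear product on vector fields such that $\mathcal L_{X\circ Y}(\circ)=X\circ\mathcal L_Y(\circ)+Y\circ\mathcal L_X(\circ)$ for all vector fields $X,Y$, and $e$ is a vector field with $e\circ X=X$ for all $X$. (Pseudo-)Riemannian F-manifold with Killing unit vector field: an F-manifold $(M,\circ,e)$ with a (pseudo-)Riemannian metric $g$ such that (i) $g(X\circ Y,Z)=g(X,Y\circ Z)$; (ii) the Riemann tensor $R$ of $g$ satisfies $R(Y,Z)(X\circ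 W)+R(X,Y)(Z\circ W)+R(Z,X)(Y\circ W)=0$ for all vector fields $X,Y,Z,W$; (iii) $\mathcal L_e g=0$. It is homogeneous if it is equipped with a vector field $E$ (the Euler vector field) such that $\mathcal L_E\circ=\circ$ and $\mathcal L_E g=Dg$ for some constant $D$. Associated flat connection: for such $(M,\circ,g,e)$, with $\theta(X):=g(e,X)$, it is the unique torsionless connection $\nabla$ satisfying $(\nabla_X g)(Y,Z)=\frac12 d\theta(X\circ Y,Z)+\frac12 d\theta(X\circ Z,Y)$ for all vector fields $X,Y,Z$. It is a known fact that it exists and that $(M,\circ,\nabla,e)$ is a flat F-manifold: $\nabla$ is flat, $\nabla e=0$, and $(\nabla_X c)(Y,Z)$ is symmetric in $X,Y,Z$, where $c(X,Y)=X\circ Y$. A vector field $\overline X$ is invertible if there is a vector field $\overline X^{-1}$ with $\overline X\circ \overline X^{-1}=e$. A Legendre vector field is an invertible vector field $\overline X$ satisfying $c^i_{jl}\nabla_k\overline X^l=c^i_{kl}\nabla_j\overline X^l$ in local coordinates, where $c^i_{jk}$ are the structure constants of $\circ$; equivalently $Y\circ\nabla_Z\overline X=Z\circ\nabla_Y\overline X$ for all vector fields $Y,Z$. *)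

theory Defs
  imports "HOL-Analysis.Analysis" "HOL-Library.Function_Algebras"
begin

text \<open>
  The smooth manifold is the union \<open>mcarrier A\<close> of the chart domains of a smooth atlas \<open>A\<close> of
  pairs (domain, coordinate map), an open subset of a second countable Hausdorff space.
  Tangent vectors are derivations of germs of smooth functions. Local objects are total functions
  of which only the values on the open set under consideration matter, so all identities between
  local vector fields are stated on an arbitrary open \<open>U \<subseteq> mcarrier A\<close> and at the points of \<open>U\<close>.
  Sums and differences of tangent vectors and vector fields are the pointwise ones of
  \<^theory>\<open>HOL-Library.Function_Algebras\<close>.
\<close>

type_synonym ('a, 'b) chart = "'a set \<times> ('a \<Rightarrow> 'b)"
type_synonym 'a tvec = "('a \<Rightarrow> real) \<Rightarrow> real"
type_synonym 'a vfield = "'a \<Rightarrow> 'a tvec"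
type_synonym 'a product = "'a \<Rightarrow> 'a tvec \<Rightarrow> 'a tvec \<Rightarrow> 'a tvec"
type_synonym 'a bilinear_form = "'a \<Rightarrow> 'a tvec \<Rightarrow> 'a tvec \<Rightarrow> real"
type_synonym 'a connection = "'a vfield \<Rightarrow> 'a vfield \<Rightarrow> 'a vfield"

section \<open>Smooth manifolds\<close>

text \<open>\<open>Ck_on k S f\<close>: for open \<open>S\<close>, \<open>f\<close> is \<open>k\<close> times continuously differentiable on \<open>S\<close>; for
  \<open>k > 0\<close> all directional derivatives are required to be \<open>k - 1\<close> times so.\<close>

fun Ck_on :: "nat \<Rightarrow> 'b::real_normed_vector set \<Rightarrow> ('b \<Rightarrow> 'c::real_normed_vector) \<Rightarrow> bool" where
  "Ck_on 0 S f = continuous_on S f"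
| "Ck_on (Suc k) S f =
     ((\<forall>x\<in>S. f differentiable at x) \<and> (\<forall>w. Ck_on k S (\<lambda>x. frechet_derivative f (at x) w)))"

definition smooth_on :: "'b::real_normed_vector set \<Rightarrow> ('b \<Rightarrow> 'c::real_normed_vector) \<Rightarrow> bool" where
  "smooth_on S f \<longleftrightarrow> (\<forall>k. Ck_on k S f)"

definition smooth_atlas ::
    "('a::{t2_space,second_countable_topology}, 'b::euclidean_space) chart set \<Rightarrow> bool" where
  "smooth_atlas A \<longleftrightarrow>
     (\<forall>(U, \<phi>)\<in>A. open U \<and> open (\<phi> ` U) \<and> homeomorphism U (\<phi> ` U) \<phi> (inv_into U \<phi>)) \<and>
     (\<forall>(U, \<phi>)\<in>A. \<forall>(V, \<psi>)\<in>A. smooth_on (\<phi> ` (U \<inter> V)) (\<psi> \<circ> inv_into U \<phi>))"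

definition mcarrier :: "('a, 'b) chart set \<Rightarrow> 'a set" where
  "mcarrier A = (\<Union>(U, \<phi>)\<in>A. U)"

definition opens :: "('a::topological_space, 'b) chart set \<Rightarrow> 'a set set" where
  "opens A = {U. open U \<and> U \<subseteq> mcarrier A}"

definition smooth_fun ::
    "('a::topological_space, 'b::euclidean_space) chart set \<Rightarrow> 'a set \<Rightarrow> ('a \<Rightarrow> real) \<Rightarrow> bool" where
  "smooth_fun A U f \<longleftrightarrow> (\<forall>(V, \<phi>)\<in>A. smooth_on (\<phi> ` (U \<inter> V)) (f \<circ> inv_into V \<phi>))"

definition smooth_near ::
    "('a::topological_space, 'b::euclidean_space) chart set \<Rightarrow> 'a \<Rightarrow> ('a \<Rightarrow> real) \<Rightarrow> bool" where
  "smooth_near A p f \<longleftrightarrow> (\<exists>U\<in>opens A. p \<in> U \<and> smooth_fun A U f)"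

text \<open>A tangent vector takes the junk value 0 on functions that are not smooth near \<open>p\<close>, so that
  equality in \<open>tangent_space A p\<close> is equality of derivations.\<close>

definition tangent_space ::
    "('a::topological_space, 'b::euclidean_space) chart set \<Rightarrow> 'a \<Rightarrow> 'a tvec set" where
  "tangent_space A p = {v.
     (\<forall>f. \<not> smooth_near A p f \<longrightarrow> v f = 0) \<and>
     (\<forall>f h. (\<forall>\<^sub>F q in nhds p. f q = h q) \<longrightarrow> v f = v h) \<and>
     (\<forall>f h. smooth_near A p f \<longrightarrow> smooth_near A p h \<longrightarrow>
        v (\<lambda>q. f q + h q) = v f + v h \<and> v (\<lambda>q. f q * h q) = f p * v h + h p * v f) \<and>
     (\<forall>f a. smooth_near A p f \<longrightarrow> v (\<lambda>q. a * f q) = a * v f)}"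

text \<open>\<open>vfields A U\<close>: the smooth vector fields on the open set \<open>U\<close>.\<close>

definition vfields ::
    "('a::topological_space, 'b::euclidean_space) chart set \<Rightarrow> 'a set \<Rightarrow> 'a vfield set" where
  "vfields A U = {X.
     (\<forall>p\<in>U. X p \<in> tangent_space A p) \<and>
     (\<forall>V f. V \<in> opens A \<longrightarrow> V \<subseteq> U \<longrightarrow> smooth_fun A V f \<longrightarrow> smooth_fun A V (\<lambda>p. X p f))}"

definition tscale :: "real \<Rightarrow> 'a tvec \<Rightarrow> 'a tvec" where
  "tscale a v = (\<lambda>f. a * v f)"

definition fscale :: "('a \<Rightarrow> real) \<Rightarrow> 'a vfield \<Rightarrow> 'a vfield" where
  "fscale f X = (\<lambda>p. tscale (f p) (X p))"

definition act :: "'a vfield \<Rightarrow> ('a \<Rightarrow> real) \<Rightarrow> 'a \<Rightarrow> real" where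
  "act X f = (\<lambda>p. X p f)"

definition lie_bracket ::
    "('a::topological_space, 'b::euclidean_space) chart set \<Rightarrow> 'a vfield \<Rightarrow> 'a vfield \<Rightarrow> 'a vfield" where
  "lie_bracket A X Y =
     (\<lambda>p f. if smooth_near A p f then act X (act Y f) p - act Y (act X f) p else 0)"

section \<open>Products, metrics and connections\<close>

definition mult :: "'a product \<Rightarrow> 'a vfield \<Rightarrow> 'a vfield \<Rightarrow> 'a vfield" where
  "mult c X Y = (\<lambda>p. c p (X p) (Y p))"

definition pairing :: "'a bilinear_form \<Rightarrow> 'a vfield \<Rightarrow> 'a vfield \<Rightarrow> 'a \<Rightarrow> real" where
  "pairing g X Y = (\<lambda>p. g p (X p) (Y p))"

definition is_product ::
    "('a::topological_space, 'b::euclidean_space) chart set \<Rightarrow> 'a product \<Rightarrow> bool" where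
  "is_product A c \<longleftrightarrow>
     (\<forall>p\<in>mcarrier A. \<forall>u\<in>tangent_space A p. \<forall>v\<in>tangent_space A p.
        c p u v \<in> tangent_space A p \<and>
        (\<forall>w\<in>tangent_space A p. c p (u + w) v = c p u v + c p w v \<and> c p u (v + w) = c p u v + c p u w) \<and>
        (\<forall>a. c p (tscale a u) v = tscale a (c p u v) \<and> c p u (tscale a v) = tscale a (c p u v))) \<and>
     (\<forall>U\<in>opens A. \<forall>X\<in>vfields A U. \<forall>Y\<in>vfields A U. mult c X Y \<in> vfields A U)"

definition is_metric ::
    "('a::topological_space, 'b::euclidean_space) chart set \<Rightarrow> 'a bilinear_form \<Rightarrow> bool" where
  "is_metric A g \<longleftrightarrow>
     (\<forall>p\<in>mcarrier A. \<forall>u\<in>tangent_space A p. \<forall>v\<in>tangent_space A p.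
        g p u v = g p v u \<and>
        (\<forall>w\<in>tangent_space A p. g p (u + w) v = g p u v + g p w v) \<and>
        (\<forall>a. g p (tscale a u) v = a * g p u v)) \<and>
     (\<forall>p\<in>mcarrier A. \<forall>u\<in>tangent_space A p. (\<forall>v\<in>tangent_space A p. g p u v = 0) \<longrightarrow> u = 0) \<and>
     (\<forall>U\<in>opens A. \<forall>X\<in>vfields A U. \<forall>Y\<in>vfields A U. smooth_fun A U (pairing g X Y))"

text \<open>A connection acts on local vector fields; the second clause says that \<open>nabla X Y\<close> on \<open>U\<close>
  depends only on \<open>X\<close> and \<open>Y\<close> on \<open>U\<close>.\<close>

definition is_connection ::
    "('a::topological_space, 'b::euclidean_space) chart set \<Rightarrow> 'a connection \<Rightarrow> bool" where
  "is_connection A nabla \<longleftrightarrow> (\<forall>U\<in>opens A.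
     (\<forall>X\<in>vfields A U. \<forall>Y\<in>vfields A U. nabla X Y \<in> vfields A U) \<and>
     (\<forall>X\<in>vfields A U. \<forall>X'\<in>vfields A U. \<forall>Y\<in>vfields A U. \<forall>Y'\<in>vfields A U.
        (\<forall>p\<in>U. X p = X' p \<and> Y p = Y' p) \<longrightarrow> (\<forall>p\<in>U. nabla X Y p = nabla X' Y' p)) \<and>
     (\<forall>X\<in>vfields A U. \<forall>Y\<in>vfields A U. \<forall>Z\<in>vfields A U. \<forall>p\<in>U.
        nabla (X + Y) Z p = (nabla X Z + nabla Y Z) p \<and>
        nabla X (Y + Z) p = (nabla X Y + nabla X Z) p) \<and>
     (\<forall>X\<in>vfields A U. \<forall>Y\<in>vfields A U. \<forall>f. smooth_fun A U f \<longrightarrow> (\<forall>p\<in>U.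
        nabla (fscale f X) Y p = fscale f (nabla X Y) p \<and>
        nabla X (fscale f Y) p = (fscale f (nabla X Y) + fscale (act X f) Y) p)))"

definition torsionless ::
    "('a::topological_space, 'b::euclidean_space) chart set \<Rightarrow> 'a connection \<Rightarrow> bool" where
  "torsionless A nabla \<longleftrightarrow>
     (\<forall>U\<in>opens A. \<forall>X\<in>vfields A U. \<forall>Y\<in>vfields A U. \<forall>p\<in>U.
        (nabla X Y - nabla Y X) p = lie_bracket A X Y p)"

text \<open>\<open>(\<nabla>\<^sub>X g)(Y, Z)\<close>\<close>

definition cov_deriv_form ::
    "'a connection \<Rightarrow> 'a bilinear_form \<Rightarrow> 'a vfield \<Rightarrow> 'a vfield \<Rightarrow> 'a vfield \<Rightarrow> 'a \<Rightarrow> real" where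
  "cov_deriv_form nabla g X Y Z =
     act X (pairing g Y Z) - pairing g (nabla X Y) Z - pairing g Y (nabla X Z)"

definition levi_civita ::
    "('a::topological_space, 'b::euclidean_space) chart set \<Rightarrow> 'a bilinear_form \<Rightarrow> 'a connection \<Rightarrow> bool" where
  "levi_civita A g nabla \<longleftrightarrow> is_connection A nabla \<and> torsionless A nabla \<and>
     (\<forall>U\<in>opens A. \<forall>X\<in>vfields A U. \<forall>Y\<in>vfields A U. \<forall>Z\<in>vfields A U. \<forall>p\<in>U.
        cov_deriv_form nabla g X Y Z p = 0)"

text \<open>\<open>riemann A nabla X Y Z\<close> is \<open>R(X, Y)Z\<close>.\<close>

definition riemann ::
    "('a::topological_space, 'b::euclidean_space) chart set \<Rightarrow> 'a connection \<Rightarrow>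
     'a vfield \<Rightarrow> 'a vfield \<Rightarrow> 'a vfield \<Rightarrow> 'a vfield" where
  "riemann A nabla X Y Z =
     nabla X (nabla Y Z) - nabla Y (nabla X Z) - nabla (lie_bracket A X Y) Z"

text \<open>\<open>(\<L>\<^sub>X c)(Y, Z)\<close> and \<open>(\<L>\<^sub>X g)(Y, Z)\<close>; the Lie derivative of a vector field is
  \<^const>\<open>lie_bracket\<close>.\<close>

definition lie_product ::
    "('a::topological_space, 'b::euclidean_space) chart set \<Rightarrow> 'a product \<Rightarrow>
     'a vfield \<Rightarrow> 'a vfield \<Rightarrow> 'a vfield \<Rightarrow> 'a vfield" where
  "lie_product A c X Y Z =
     lie_bracket A X (mult c Y Z) - mult c (lie_bracket A X Y) Z - mult c Y (lie_bracket A X Z)"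

definition lie_form ::
    "('a::topological_space, 'b::euclidean_space) chart set \<Rightarrow> 'a bilinear_form \<Rightarrow>
     'a vfield \<Rightarrow> 'a vfield \<Rightarrow> 'a vfield \<Rightarrow> 'a \<Rightarrow> real" where
  "lie_form A g X Y Z =
     act X (pairing g Y Z) - pairing g (lie_bracket A X Y) Z - pairing g Y (lie_bracket A X Z)"

text \<open>The exterior derivative of the 1-form \<open>\<theta>\<close>, evaluated on two vector fields.\<close>

definition ext_deriv ::
    "('a::topological_space, 'b::euclidean_space) chart set \<Rightarrow> ('a \<Rightarrow> 'a tvec \<Rightarrow> real) \<Rightarrow>
     'a vfield \<Rightarrow> 'a vfield \<Rightarrow> 'a \<Rightarrow> real" where
  "ext_deriv A \<theta> X Y =
     act X (\<lambda>q. \<theta> q (Y q)) - act Y (\<lambda>q. \<theta> q (X q)) - (\<lambda>q. \<theta> q (lie_bracket A X Y q))"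

section \<open>F-manifolds\<close>

definition F_manifold ::
    "('a::{t2_space,second_countable_topology}, 'b::euclidean_space) chart set \<Rightarrow>
     'a product \<Rightarrow> 'a vfield \<Rightarrow> bool" where
  "F_manifold A c e \<longleftrightarrow> smooth_atlas A \<and> is_product A c \<and> e \<in> vfields A (mcarrier A) \<and>
     (\<forall>U\<in>opens A. \<forall>X\<in>vfields A U. \<forall>Y\<in>vfields A U. \<forall>Z\<in>vfields A U. \<forall>p\<in>U.
        mult c X Y p = mult c Y X p \<and>
        mult c (mult c X Y) Z p = mult c X (mult c Y Z) p \<and>
        mult c e X p = X p) \<and>
     (\<forall>U\<in>opens A. \<forall>X\<in>vfields A U. \<forall>Y\<in>vfields A U. \<forall>Z\<in>vfields A U. \<forall>W\<in>vfields A U. \<forall>p\<in>U.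
        lie_product A c (mult c X Y) Z W p =
        (mult c X (lie_product A c Y Z W) + mult c Y (lie_product A c X Z W)) p)"

text \<open>The Riemann tensor of \<open>g\<close> is that of its Levi-Civita connection \<open>lc\<close>, whose existence and
  uniqueness (on local vector fields) is the fundamental theorem of Riemannian geometry.\<close>

definition riemannian_F_manifold ::
    "('a::{t2_space,second_countable_topology}, 'b::euclidean_space) chart set \<Rightarrow>
     'a product \<Rightarrow> 'a bilinear_form \<Rightarrow> 'a vfield \<Rightarrow> bool" where
  "riemannian_F_manifold A c g e \<longleftrightarrow> F_manifold A c e \<and> is_metric A g \<and>
     (\<forall>U\<in>opens A. \<forall>X\<in>vfields A U. \<forall>Y\<in>vfields A U. \<forall>Z\<in>vfields A U. \<forall>p\<in>U.
        pairing g (mult c X Y) Z p = pairing g X (mult c Y Z) p) \<and>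
     (\<exists>lc. levi_civita A g lc \<and>
       (\<forall>U\<in>opens A. \<forall>X\<in>vfields A U. \<forall>Y\<in>vfields A U. \<forall>Z\<in>vfields A U. \<forall>W\<in>vfields A U. \<forall>p\<in>U.
          (riemann A lc Y Z (mult c X W) + riemann A lc X Y (mult c Z W)
             + riemann A lc Z X (mult c Y W)) p = 0)) \<and>
     (\<forall>U\<in>opens A. \<forall>X\<in>vfields A U. \<forall>Y\<in>vfields A U. \<forall>p\<in>U. lie_form A g e X Y p = 0)"

definition homogeneous_riemannian_F_manifold ::
    "('a::{t2_space,second_countable_topology}, 'b::euclidean_space) chart set \<Rightarrow>
     'a product \<Rightarrow> 'a bilinear_form \<Rightarrow> 'a vfield \<Rightarrow> 'a vfield \<Rightarrow> bool" where
  "homogeneous_riemannian_F_manifold A c g e E \<longleftrightarrow>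
     riemannian_F_manifold A c g e \<and> E \<in> vfields A (mcarrier A) \<and>
     (\<forall>U\<in>opens A. \<forall>X\<in>vfields A U. \<forall>Y\<in>vfields A U. \<forall>p\<in>U.
        lie_product A c E X Y p = mult c X Y p) \<and>
     (\<exists>D. \<forall>U\<in>opens A. \<forall>X\<in>vfields A U. \<forall>Y\<in>vfields A U. \<forall>p\<in>U.
        lie_form A g E X Y p = D * pairing g X Y p)"

definition associated_connection ::
    "('a::topological_space, 'b::euclidean_space) chart set \<Rightarrow>
     'a product \<Rightarrow> 'a bilinear_form \<Rightarrow> 'a vfield \<Rightarrow> 'a connection \<Rightarrow> bool" where
  "associated_connection A c g e nabla \<longleftrightarrow>
     is_connection A nabla \<and> torsionless A nabla \<and>
     (let \<theta> = (\<lambda>p v. g p (e p) v) in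
      \<forall>U\<in>opens A. \<forall>X\<in>vfields A U. \<forall>Y\<in>vfields A U. \<forall>Z\<in>vfields A U. \<forall>p\<in>U.
        cov_deriv_form nabla g X Y Z p =
        1/2 * ext_deriv A \<theta> (mult c X Y) Z p + 1/2 * ext_deriv A \<theta> (mult c X Z) Y p)"

definition invertible_vfield ::
    "('a::topological_space, 'b::euclidean_space) chart set \<Rightarrow>
     'a product \<Rightarrow> 'a vfield \<Rightarrow> 'a vfield \<Rightarrow> bool" where
  "invertible_vfield A c e X \<longleftrightarrow> X \<in> vfields A (mcarrier A) \<and>
     (\<exists>X'\<in>vfields A (mcarrier A). \<forall>p\<in>mcarrier A. mult c X X' p = e p)"

definition legendre_vfield ::
    "('a::topological_space, 'b::euclidean_space) chart set \<Rightarrow>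
     'a product \<Rightarrow> 'a vfield \<Rightarrow> 'a connection \<Rightarrow> 'a vfield \<Rightarrow> bool" where
  "legendre_vfield A c e nabla X \<longleftrightarrow> invertible_vfield A c e X \<and>
     (\<forall>U\<in>opens A. \<forall>Y\<in>vfields A U. \<forall>Z\<in>vfields A U. \<forall>p\<in>U.
        mult c Y (nabla Z X) p = mult c Z (nabla Y X) p)"

definition flat_vfield ::
    "('a::topological_space, 'b::euclidean_space) chart set \<Rightarrow> 'a connection \<Rightarrow> 'a vfield \<Rightarrow> bool" where
  "flat_vfield A nabla X \<longleftrightarrow> (\<forall>U\<in>opens A. \<forall>Y\<in>vfields A U. \<forall>p\<in>U. nabla Y X p = 0)"

end

theory Submission
  imports Defs
begin

text \<open>
  Write \<open>D\<close> for the Levi-Civita connection of \<open>g\<close>, \<open>\<omega>(Y, Z) = g(D\<^sub>Y e, Z)\<close>, and \<open>X\<close> for the flat Legendre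
  field. Multiplication by \<open>X\<close> is an isometry from the new metric to \<open>g\<close>, so conjugating \<open>D\<close> by it yields
  a connection \<open>D'\<^sub>Y Z = X\<inverse> \<circ> D\<^sub>Y (X \<circ> Z)\<close> that is metric for the new metric and whose curvature is
  \<open>R'(Y, Z) W = X\<inverse> \<circ> R(Y, Z) (X \<circ> W)\<close>. If \<open>D'\<close> is torsionless, it is the Levi-Civita connection of the new
  metric, and the curvature condition for \<open>W\<close> is that of \<open>g\<close> for \<open>X \<circ> W\<close>.

  The torsion vanishes for the following reason. As \<open>e\<close> is Killing, \<open>\<omega>\<close> is antisymmetric, and a Koszul
  argument gives \<open>\<nabla>\<^sub>Y Z = D\<^sub>Y Z - D\<^sub>Y\<^sub>\<circ>\<^sub>Z e\<close> for the associated connection (\<open>lc_eq_associated\<close>). The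
  F-manifold identity paired with \<open>e\<close> determines the antisymmetric part of the covariant derivative of
  the product:
  \<open>g((D\<^sub>Y c)(Z, V) - (D\<^sub>Z c)(Y, V), W) = \<omega>(Z \<circ> V, Y \<circ> W) - \<omega>(Y \<circ> V, Z \<circ> W)\<close>
  (\<open>dcov_antisymmetrized\<close>). For \<open>V = X\<close> this is cancelled by the derivatives of \<open>X\<close>, which are
  \<open>D\<^sub>Y X = D\<^sub>Y\<^sub>\<circ>\<^sub>X e\<close> by flatness (\<open>legendre_torsion\<close>).

  Lie derivatives of the new metric follow from the Leibniz rule (\<open>legendre_metric_lie_form\<close>): along \<open>e\<close>
  the metric, the product and \<open>X\<close> are all invariant, and along \<open>E\<close> they are homogeneous, of weights \<open>k\<close>
  (say), 1 and \<open>d\<close>, so that the new metric has weight \<open>k + 2 (1 + d)\<close>.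

  The algebra takes place at a point, whereas the axioms speak of local vector fields. The bridge is
  that every tangent vector, a derivation of germs, extends to a local vector field (\<open>tangent_extends\<close>);
  this rests on Hadamard's lemma.
\<close>

section \<open>Calculus of smooth functions on open sets\<close>

text \<open>Openness matters: the derivatives in \<^const>\<open>Ck_on\<close> are not taken within \<open>S\<close>, so they see a whole
neighbourhood of the point.\<close>

lemma Ck_on_cong:
  assumes "open S" "\<And>x. x \<in> S \<Longrightarrow> f x = g x"
  shows "Ck_on k S f \<longleftrightarrow> Ck_on k S g"
  using assms(2)
proof (induction k arbitrary: f g)
  case 0
  then show ?case by (simp cong: continuous_on_cong)
next
  case (Suc k)
  have hd: "(f has_derivative D) (at x) \<longleftrightarrow> (g has_derivative D) (at x)" if "x \<in> S" for x D
    using that Suc.prems \<open>open S\<close> has_derivative_transform_within_open[of f D x UNIV S g]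
      has_derivative_transform_within_open[of g D x UNIV S f] by auto
  then have "f differentiable at x \<longleftrightarrow> g differentiable at x" if "x \<in> S" for x
    using that by (simp add: differentiable_def)
  moreover have "frechet_derivative f (at x) = frechet_derivative g (at x)" if "x \<in> S" for x
    using hd that by (simp add: frechet_derivative_def)
  then have "Ck_on k S (\<lambda>x. frechet_derivative f (at x) w) =
      Ck_on k S (\<lambda>x. frechet_derivative g (at x) w)" for w
    by (intro Suc.IH) simp
  ultimately show ?case by simp
qed

lemma Ck_on_subset: "Ck_on k S f \<Longrightarrow> T \<subseteq> S \<Longrightarrow> Ck_on k T f"
  by (induction k arbitrary: f) (auto intro: continuous_on_subset)

lemma Ck_on_Suc_imp: "Ck_on (Suc k) S f \<Longrightarrow> Ck_on k S f"
proof (induction k arbitrary: f)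
  case 0
  then show ?case
    by (auto intro!: continuous_at_imp_continuous_on differentiable_imp_continuous_within)
next
  case (Suc k)
  then show ?case by (metis Ck_on.simps(2))
qed

text \<open>Every closure property below is proved by exhibiting a derivative that is visibly of class \<open>k\<close>;
this rule replaces it for \<^const>\<open>frechet_derivative\<close>.\<close>

lemma Ck_on_SucI:
  assumes "open S"
    and "\<And>x. x \<in> S \<Longrightarrow> (f has_derivative f' x) (at x)"
    and "\<And>w. Ck_on k S (\<lambda>x. f' x w)"
  shows "Ck_on (Suc k) S f"
proof -
  have "frechet_derivative f (at x) = f' x" if "x \<in> S" for x
    using assms(2)[OF that] frechet_derivative_at by metis
  then have "Ck_on k S (\<lambda>x. frechet_derivative f (at x) w)" for w
    using Ck_on_cong[OF assms(1), of "\<lambda>x. frechet_derivative f (at x) w" "\<lambda>x. f' x w" k] assms(3) by simp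
  then show ?thesis using assms(2) by (auto simp: differentiable_def)
qed

lemma Ck_on_SucD:
  assumes "Ck_on (Suc k) S f"
  shows "\<And>x. x \<in> S \<Longrightarrow> (f has_derivative frechet_derivative f (at x)) (at x)"
    and "\<And>w. Ck_on k S (\<lambda>x. frechet_derivative f (at x) w)"
  using assms by (auto simp: frechet_derivative_works)

lemma Ck_on_const: "open S \<Longrightarrow> Ck_on k S (\<lambda>x. a)"
proof (induction k arbitrary: a)
  case (Suc k)
  show ?case by (rule Ck_on_SucI[where f' = "\<lambda>x w. 0"]) (use Suc in auto)
qed simp

lemma Ck_on_bounded_linear:
  assumes "open S" "bounded_linear l" "Ck_on k S f"
  shows "Ck_on k S (\<lambda>x. l (f x))"
  using assms(3)
proof (induction k arbitrary: f)
  case 0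
  then show ?case using assms(2) by (auto intro: bounded_linear.continuous_on)
next
  case (Suc k)
  note f = Ck_on_SucD[OF Suc.prems]
  show ?case
    by (rule Ck_on_SucI[where f' = "\<lambda>x w. l (frechet_derivative f (at x) w)"])
      (use assms f Suc.IH in \<open>auto intro: bounded_linear.has_derivative\<close>)
qed

lemma Ck_on_add:
  assumes "open S" "Ck_on k S f" "Ck_on k S g"
  shows "Ck_on k S (\<lambda>x. f x + g x)"
  using assms(2,3)
proof (induction k arbitrary: f g)
  case 0
  then show ?case by (auto intro: continuous_intros)
next
  case (Suc k)
  note f = Ck_on_SucD[OF Suc.prems(1)] and g = Ck_on_SucD[OF Suc.prems(2)]
  show ?case
    by (rule Ck_on_SucI[where f' = "\<lambda>x w. frechet_derivative f (at x) w + frechet_derivative g (at x) w"])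
      (use assms(1) f g Suc.IH in \<open>auto intro: has_derivative_add\<close>)
qed

lemma Ck_on_mult:
  fixes f g :: "'b::real_normed_vector \<Rightarrow> real"
  assumes "open S" "Ck_on k S f" "Ck_on k S g"
  shows "Ck_on k S (\<lambda>x. f x * g x)"
  using assms(2,3)
proof (induction k arbitrary: f g)
  case 0
  then show ?case by (auto intro: continuous_intros)
next
  case (Suc k)
  note f = Ck_on_SucD[OF Suc.prems(1)] and g = Ck_on_SucD[OF Suc.prems(2)]
  show ?case
    by (rule Ck_on_SucI[where f' = "\<lambda>x w. f x * frechet_derivative g (at x) w + frechet_derivative f (at x) w * g x"])
      (use assms(1) f g Suc.IH Suc.prems[THEN Ck_on_Suc_imp] in
        \<open>auto intro: has_derivative_mult Ck_on_add\<close>)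
qed

lemma Ck_on_sum:
  fixes f :: "'i \<Rightarrow> 'b::real_normed_vector \<Rightarrow> real"
  assumes "open S" "\<And>i. i \<in> I \<Longrightarrow> Ck_on k S (f i)"
  shows "Ck_on k S (\<lambda>x. \<Sum>i\<in>I. f i x)"
proof (cases "finite I")
  case True
  then show ?thesis using assms(2)
    by (induction I) (auto intro: Ck_on_const Ck_on_add assms(1))
qed (use assms in \<open>auto intro: Ck_on_const\<close>)

text \<open>Expanding the outer derivative in a basis turns the chain rule into a finite sum of products of
real functions, one factor of which is again a composition, with a partial derivative of \<open>f\<close>.\<close>

lemma Ck_on_compose:
  fixes f :: "'b::euclidean_space \<Rightarrow> real" and h :: "'c::real_normed_vector \<Rightarrow> 'b"
  assumes "open S" "open T" "h ` S \<subseteq> T" "Ck_on k T f" "Ck_on k S h"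
  shows "Ck_on k S (\<lambda>x. f (h x))"
  using assms(4,5)
proof (induction k arbitrary: f)
  case 0
  then show ?case using assms(3) by (auto intro: continuous_on_compose2)
next
  case (Suc k)
  note f = Ck_on_SucD[OF Suc.prems(1)] and h = Ck_on_SucD[OF Suc.prems(2)]
  let ?f' = "\<lambda>x w. \<Sum>i\<in>Basis. (frechet_derivative h (at x) w \<bullet> i) * frechet_derivative f (at (h x)) i"
  have "((\<lambda>x. f (h x)) has_derivative ?f' x) (at x)" if x: "x \<in> S" for x
  proof -
    have fx: "(f has_derivative frechet_derivative f (at (h x))) (at (h x))"
      using x assms(3) by (auto intro!: f)
    then have lin: "linear (frechet_derivative f (at (h x)))"
      by (rule has_derivative_linear)
    have "frechet_derivative f (at (h x)) v = (\<Sum>i\<in>Basis. (v \<bullet> i) * frechet_derivative f (at (h x)) i)" for v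
    proof -
      have "frechet_derivative f (at (h x)) v = frechet_derivative f (at (h x)) (\<Sum>i\<in>Basis. (v \<bullet> i) *\<^sub>R i)"
        by (simp add: euclidean_representation)
      also have "\<dots> = (\<Sum>i\<in>Basis. (v \<bullet> i) * frechet_derivative f (at (h x)) i)"
        by (simp only: linear_sum[OF lin] linear_cmul[OF lin] real_scaleR_def)
      finally show ?thesis .
    qed
    then have "frechet_derivative f (at (h x)) \<circ> frechet_derivative h (at x) = ?f' x"
      unfolding o_def by (intro ext)
    then show ?thesis
      using diff_chain_at[OF h(1)[OF x] fx] by (simp add: o_def)
  qed
  moreover have "Ck_on k S (\<lambda>x. ?f' x w)" for w
  proof (intro Ck_on_sum Ck_on_mult assms(1) Suc.IH f h Ck_on_Suc_imp[OF Suc.prems(2)])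
    fix i :: 'b
    show "Ck_on k S (\<lambda>x. frechet_derivative h (at x) w \<bullet> i)"
      by (rule Ck_on_bounded_linear[OF assms(1) bounded_linear_inner_left h(2)])
  qed
  ultimately show ?case by (intro Ck_on_SucI[OF assms(1)])
qed

lemma smooth_onD:
  assumes "smooth_on S f"
  shows "\<And>x. x \<in> S \<Longrightarrow> (f has_derivative frechet_derivative f (at x)) (at x)"
    and "\<And>w. smooth_on S (\<lambda>x. frechet_derivative f (at x) w)"
    and "continuous_on S f"
proof -
  have s: "Ck_on k S f" for k using assms by (simp add: smooth_on_def)
  show "\<And>x. x \<in> S \<Longrightarrow> (f has_derivative frechet_derivative f (at x)) (at x)"
    by (rule Ck_on_SucD(1)[OF s])
  show "\<And>w. smooth_on S (\<lambda>x. frechet_derivative f (at x) w)"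
    using Ck_on_SucD(2)[OF s] by (simp add: smooth_on_def)
  show "continuous_on S f" using s[of 0] by simp
qed

text \<open>Differentiation under the integral sign. The factor \<open>t ^ m\<close> is there because each derivative in \<open>x\<close>
produces one more factor \<open>t\<close>, so that the family of such integrals is closed under differentiation.\<close>

lemma integral_rescaled_has_derivative:
  fixes G :: "'b::euclidean_space \<Rightarrow> real"
  assumes G: "smooth_on (ball a r) G" and x: "x \<in> ball a r"
  shows "((\<lambda>x. integral {0..1} (\<lambda>t. t ^ m * G (a + t *\<^sub>R (x - a)))) has_derivative
      (\<lambda>w. integral {0..1} (\<lambda>t. t ^ Suc m * frechet_derivative G (at (a + t *\<^sub>R (x - a))) w))) (at x)"
proof -
  let ?\<gamma> = "\<lambda>x t. a + t *\<^sub>R (x - a)"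
  let ?G' = "\<lambda>y. frechet_derivative G (at y)"
  define fx where "fx x t = Blinfun (\<lambda>w. t ^ Suc m * ?G' (?\<gamma> x t) w)" for x t
  have \<gamma>: "?\<gamma> x t \<in> ball a r" if "x \<in> ball a r" "t \<in> {0..1}" for x t
  proof -
    have "norm (t *\<^sub>R (x - a)) \<le> norm (x - a)" using that by (auto intro: mult_left_le_one_le)
    then show ?thesis using that by (simp add: dist_norm norm_minus_commute)
  qed
  have bl: "bounded_linear (\<lambda>w. t ^ Suc m * ?G' (?\<gamma> x t) w)" if "x \<in> ball a r" "t \<in> {0..1}" for x t
    by (rule bounded_linear_const_mult[OF has_derivative_bounded_linear[OF smooth_onD(1)[OF G \<gamma>[OF that]]]])
  then have fx: "blinfun_apply (fx x t) = (\<lambda>w. t ^ Suc m * ?G' (?\<gamma> x t) w)"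
    if "x \<in> ball a r" "t \<in> {0..1}" for x t
    unfolding fx_def using that by (simp add: bounded_linear_Blinfun_apply)
  have cont: "continuous_on (ball a r \<times> cbox 0 1) (\<lambda>(x, t). fx x t)"
  proof (rule continuous_on_blinfun_componentwise)
    fix i :: 'b
    have "continuous_on (ball a r \<times> {0..1}) (\<lambda>z. snd z ^ Suc m * ?G' (?\<gamma> (fst z) (snd z)) i)"
      using \<gamma> by (intro continuous_intros continuous_on_compose2[OF smooth_onD(3)[OF smooth_onD(2)[OF G]]])
        (auto intro!: continuous_intros simp del: mem_ball)
    then show "continuous_on (ball a r \<times> cbox 0 1) (\<lambda>z. blinfun_apply (case z of (x, t) \<Rightarrow> fx x t) i)"
      by (subst continuous_on_cong[OF refl,
            where g = "\<lambda>z. snd z ^ Suc m * ?G' (?\<gamma> (fst z) (snd z)) i"]) (auto simp: fx)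
  qed
  have "((\<lambda>x. integral (cbox 0 1) (\<lambda>t. t ^ m * G (?\<gamma> x t))) has_derivative
      blinfun_apply (integral (cbox 0 1) (fx x))) (at x within ball a r)"
  proof (rule leibniz_rule[OF _ _ cont x convex_ball])
    fix x t assume xt: "x \<in> ball a r" "t \<in> cbox 0 (1::real)"
    then have t: "t \<in> {0..1}" by simp
    have "((\<lambda>x. G (?\<gamma> x t)) has_derivative (\<lambda>w. ?G' (?\<gamma> x t) (t *\<^sub>R w))) (at x)"
      by (rule has_derivative_compose[where f = "\<lambda>x. ?\<gamma> x t" and g = G,
            OF _ smooth_onD(1)[OF G \<gamma>[OF xt(1) t]]])
        (auto intro!: derivative_eq_intros)
    then have "((\<lambda>x. t ^ m * G (?\<gamma> x t)) has_derivative (\<lambda>w. t ^ m * ?G' (?\<gamma> x t) (t *\<^sub>R w))) (at x)"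
      by (rule has_derivative_mult_right)
    moreover have "?G' (?\<gamma> x t) (t *\<^sub>R w) = t * ?G' (?\<gamma> x t) w" for w
      using linear_cmul[OF has_derivative_linear[OF smooth_onD(1)[OF G \<gamma>[OF xt(1) t]]]] by simp
    ultimately show "((\<lambda>x. t ^ m * G (?\<gamma> x t)) has_derivative blinfun_apply (fx x t)) (at x within ball a r)"
      unfolding fx[OF xt(1) t] by (simp add: has_derivative_at_withinI mult.assoc mult.left_commute)
  next
    fix x assume x: "x \<in> ball a r"
    have "continuous_on {0..1} (\<lambda>t. t ^ m * G (?\<gamma> x t))"
      using \<gamma>[OF x] by (intro continuous_intros continuous_on_compose2[OF smooth_onD(3)[OF G]])
        (auto intro!: continuous_intros simp del: mem_ball)
    then show "(\<lambda>t. t ^ m * G (?\<gamma> x t)) integrable_on cbox 0 1"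
      by (auto intro: integrable_continuous_real)
  qed
  moreover have "blinfun_apply (integral (cbox 0 1) (fx x)) w =
      integral {0..1} (\<lambda>t. t ^ Suc m * ?G' (?\<gamma> x t) w)" for w
  proof -
    have "continuous_on (cbox 0 1) (\<lambda>t. case (x, t) of (x, t) \<Rightarrow> fx x t)"
      by (rule continuous_on_compose2[OF cont]) (use x in \<open>auto intro!: continuous_intros\<close>)
    then have "fx x integrable_on cbox 0 1"
      using integrable_continuous[of 0 1 "fx x"] by simp
    then have "blinfun_apply (integral (cbox 0 1) (fx x)) w = integral (cbox 0 1) (\<lambda>t. blinfun_apply (fx x t) w)"
      using integral_linear[of "fx x" "cbox 0 1" "\<lambda>F. blinfun_apply F w"]
      by (simp add: o_def blinfun.bounded_linear_left)
    also have "\<dots> = integral {0..1} (\<lambda>t. t ^ Suc m * ?G' (?\<gamma> x t) w)"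
      using x by (auto intro!: integral_cong simp: fx)
    finally show ?thesis .
  qed
  then have "blinfun_apply (integral (cbox 0 1) (fx x)) =
      (\<lambda>w. integral {0..1} (\<lambda>t. t ^ Suc m * ?G' (?\<gamma> x t) w))"
    by (intro ext)
  ultimately show ?thesis unfolding at_within_open[OF x open_ball] cbox_interval by simp
qed

lemma Ck_on_integral_rescaled:
  fixes G :: "'b::euclidean_space \<Rightarrow> real"
  assumes "smooth_on (ball a r) G"
  shows "Ck_on k (ball a r) (\<lambda>x. integral {0..1} (\<lambda>t. t ^ m * G (a + t *\<^sub>R (x - a))))"
  using assms
proof (induction k arbitrary: G m)
  case 0
  then show ?case
    by (auto intro!: continuous_at_imp_continuous_on
        has_derivative_continuous[OF integral_rescaled_has_derivative])
next
  case (Suc k)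
  show ?case
    by (rule Ck_on_SucI[OF open_ball integral_rescaled_has_derivative[OF Suc.prems]])
      (auto intro: Suc.IH smooth_onD(2)[OF Suc.prems] simp del: power_Suc)
qed

text \<open>Hadamard's lemma: the coefficients are \<open>\<integral>\<^sub>0\<^sup>1 \<partial>\<^sub>i G (a + t (x - a)) dt\<close>, by the fundamental theorem of calculus
along the segment from \<open>a\<close> to \<open>x\<close>.\<close>

lemma hadamard_expansion:
  fixes G :: "'b::euclidean_space \<Rightarrow> real"
  assumes G: "smooth_on (ball a r) G"
  obtains h where "\<And>i. smooth_on (ball a r) (h i)"
    and "\<And>x. x \<in> ball a r \<Longrightarrow> G x = G a + (\<Sum>i\<in>Basis. ((x \<bullet> i) - (a \<bullet> i)) * h i x)"
proof
  let ?G' = "\<lambda>y. frechet_derivative G (at y)"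
  let ?h = "\<lambda>i x. integral {0..1} (\<lambda>t. ?G' (a + t *\<^sub>R (x - a)) i)"
  show "smooth_on (ball a r) (?h i)" for i
    using Ck_on_integral_rescaled[OF smooth_onD(2)[OF G], of _ 0] by (simp add: smooth_on_def)
  fix x assume x: "x \<in> ball a r"
  let ?\<gamma> = "\<lambda>t. a + t *\<^sub>R (x - a)"
  have \<gamma>: "?\<gamma> t \<in> ball a r" if "t \<in> {0..1}" for t
  proof -
    have "norm (t *\<^sub>R (x - a)) \<le> norm (x - a)" using that by (auto intro: mult_left_le_one_le)
    then show ?thesis using x by (simp add: dist_norm norm_minus_commute)
  qed
  have "((\<lambda>t. ?G' (?\<gamma> t) (x - a)) has_integral (G (?\<gamma> 1) - G (?\<gamma> 0))) {0..1}"
  proof (rule fundamental_theorem_of_calculus)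
    fix t :: real assume t: "t \<in> {0..1}"
    have "(?\<gamma> has_vector_derivative (x - a)) (at t)"
      by (auto intro!: derivative_eq_intros simp: has_vector_derivative_def)
    then have "((G \<circ> ?\<gamma>) has_vector_derivative ?G' (?\<gamma> t) (x - a)) (at t)"
      by (rule vector_derivative_diff_chain_within)
        (use smooth_onD(1)[OF G \<gamma>[OF t]] in \<open>auto intro: has_derivative_at_withinI\<close>)
    then show "((\<lambda>t. G (?\<gamma> t)) has_vector_derivative ?G' (?\<gamma> t) (x - a)) (at t within {0..1})"
      by (simp add: o_def has_vector_derivative_at_within)
  qed simp
  then have "G x - G a = integral {0..1} (\<lambda>t. ?G' (?\<gamma> t) (x - a))"
    by (simp add: integral_unique)
  also have "\<dots> = integral {0..1} (\<lambda>t. \<Sum>i\<in>Basis. ((x \<bullet> i) - (a \<bullet> i)) * ?G' (?\<gamma> t) i)"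
  proof (rule integral_cong)
    fix t :: real assume t: "t \<in> {0..1}"
    have lin: "linear (?G' (?\<gamma> t))" by (rule has_derivative_linear[OF smooth_onD(1)[OF G \<gamma>[OF t]]])
    have "?G' (?\<gamma> t) (x - a) = ?G' (?\<gamma> t) (\<Sum>i\<in>Basis. ((x - a) \<bullet> i) *\<^sub>R i)"
      by (simp only: euclidean_representation)
    also have "\<dots> = (\<Sum>i\<in>Basis. ((x \<bullet> i) - (a \<bullet> i)) * ?G' (?\<gamma> t) i)"
      by (simp only: linear_sum[OF lin] linear_cmul[OF lin] real_scaleR_def inner_diff_left)
    finally show "?G' (?\<gamma> t) (x - a) = (\<Sum>i\<in>Basis. ((x \<bullet> i) - (a \<bullet> i)) * ?G' (?\<gamma> t) i)" .
  qed
  also have "\<dots> = (\<Sum>i\<in>Basis. ((x \<bullet> i) - (a \<bullet> i)) * ?h i x)"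
  proof -
    have "continuous_on {0..1} (\<lambda>t. ?G' (?\<gamma> t) i)" for i
      using \<gamma> by (intro continuous_on_compose2[OF smooth_onD(3)[OF smooth_onD(2)[OF G]]])
        (auto intro!: continuous_intros simp del: mem_ball)
    then have "(\<lambda>t. ((x \<bullet> i) - (a \<bullet> i)) * ?G' (?\<gamma> t) i) integrable_on {0..1}" for i
      by (intro integrable_continuous_real continuous_intros)
    then show ?thesis by (subst integral_sum) auto
  qed
  finally show "G x = G a + (\<Sum>i\<in>Basis. ((x \<bullet> i) - (a \<bullet> i)) * ?h i x)" by simp
qed

section \<open>Tangent vectors and vector fields in charts\<close>

lemma sum_vfield_apply: "(\<Sum>i\<in>I. F i) q f = (\<Sum>i\<in>I. F i q f)"
  for F :: "'i \<Rightarrow> 'a vfield"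
  by (induction I rule: infinite_finite_induct) auto

locale smooth_manifold =
  fixes A :: "('a::{t2_space,second_countable_topology}, 'b::euclidean_space) chart set"
  assumes atlas: "smooth_atlas A"
begin

lemma chart_homeomorphism:
  assumes "(V, \<phi>) \<in> A"
  shows "open V" "V \<subseteq> mcarrier A" "homeomorphism V (\<phi> ` V) \<phi> (inv_into V \<phi>)" "open (\<phi> ` V)"
  using atlas assms by (auto simp: smooth_atlas_def mcarrier_def)

lemma chart_inverse: "(V, \<phi>) \<in> A \<Longrightarrow> q \<in> V \<Longrightarrow> inv_into V \<phi> (\<phi> q) = q"
  using chart_homeomorphism(3) by (auto simp: homeomorphism_def)

lemma chart_open_map:
  assumes "(V, \<phi>) \<in> A" "open U"
  shows "open (\<phi> ` (U \<inter> V))"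
proof -
  note V = chart_homeomorphism[OF assms(1)]
  have "openin (top_of_set (\<phi> ` V)) (\<phi> ` (U \<inter> V))"
    by (rule homeomorphism_imp_open_map[OF V(3)]) (use assms in \<open>auto simp: openin_open\<close>)
  then show ?thesis using V(4) openin_open_trans by blast
qed

lemma chart_exists:
  assumes "p \<in> mcarrier A"
  obtains V \<phi> where "(V, \<phi>) \<in> A" "p \<in> V"
  using assms by (auto simp: mcarrier_def)

lemma open_mcarrier: "open (mcarrier A)"
  using chart_homeomorphism(1) by (auto simp: mcarrier_def)

lemma mcarrier_in_opens: "mcarrier A \<in> opens A"
  by (simp add: opens_def open_mcarrier)

lemma opens_Int: "U \<in> opens A \<Longrightarrow> open V \<Longrightarrow> U \<inter> V \<in> opens A"
  by (auto simp: opens_def)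

lemma smooth_fun_cong:
  assumes "open U" "\<And>q. q \<in> U \<Longrightarrow> f q = h q"
  shows "smooth_fun A U f \<longleftrightarrow> smooth_fun A U h"
proof -
  have "smooth_on (\<phi> ` (U \<inter> V)) (f \<circ> inv_into V \<phi>) \<longleftrightarrow> smooth_on (\<phi> ` (U \<inter> V)) (h \<circ> inv_into V \<phi>)"
    if "(V, \<phi>) \<in> A" for V \<phi>
    unfolding smooth_on_def using assms chart_inverse[OF that]
    by (subst Ck_on_cong[OF chart_open_map[OF that assms(1)]]) auto
  then show ?thesis by (auto simp: smooth_fun_def)
qed

lemma smooth_fun_subset: "smooth_fun A U f \<Longrightarrow> W \<subseteq> U \<Longrightarrow> smooth_fun A W f"
  unfolding smooth_fun_def smooth_on_def
  by (force intro: Ck_on_subset)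

lemma smooth_fun_const: "open U \<Longrightarrow> smooth_fun A U (\<lambda>q. a)"
  by (auto simp: smooth_fun_def smooth_on_def o_def intro!: Ck_on_const chart_open_map)

lemma smooth_fun_add:
  "open U \<Longrightarrow> smooth_fun A U f \<Longrightarrow> smooth_fun A U h \<Longrightarrow> smooth_fun A U (\<lambda>q. f q + h q)"
  by (auto simp: smooth_fun_def smooth_on_def o_def intro!: Ck_on_add chart_open_map)

lemma smooth_fun_mult:
  "open U \<Longrightarrow> smooth_fun A U f \<Longrightarrow> smooth_fun A U h \<Longrightarrow> smooth_fun A U (\<lambda>q. f q * h q)"
  by (auto simp: smooth_fun_def smooth_on_def o_def intro!: Ck_on_mult chart_open_map)

text \<open>Smoothness in one chart is smoothness in all of them: in another chart \<open>\<psi>\<close> the function is \<open>h\<close>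
composed with the smooth transition map \<open>\<phi> \<circ> \<psi>\<inverse>\<close>.\<close>

lemma smooth_fun_chart:
  assumes "(V, \<phi>) \<in> A" "open U" "U \<subseteq> V" "open T" "\<phi> ` U \<subseteq> T" "smooth_on T h"
  shows "smooth_fun A U (\<lambda>q. h (\<phi> q))"
  unfolding smooth_fun_def
proof (clarsimp simp: smooth_on_def)
  fix W \<psi> k assume W: "(W, \<psi>) \<in> A"
  have "smooth_on (\<psi> ` (W \<inter> V)) (\<phi> \<circ> inv_into W \<psi>)"
    using atlas W assms(1) by (auto simp: smooth_atlas_def)
  then have "Ck_on k (\<psi> ` (U \<inter> W)) (\<phi> \<circ> inv_into W \<psi>)"
    using assms(3) by (auto simp: smooth_on_def intro: Ck_on_subset)
  moreover have "(\<phi> \<circ> inv_into W \<psi>) ` \<psi> ` (U \<inter> W) \<subseteq> T"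
    using assms(5) chart_inverse[OF W] by auto
  ultimately have "Ck_on k (\<psi> ` (U \<inter> W)) (\<lambda>y. h ((\<phi> \<circ> inv_into W \<psi>) y))"
    using assms(6) by (intro Ck_on_compose[OF chart_open_map[OF W assms(2)] assms(4)])
      (auto simp: smooth_on_def o_def)
  then show "Ck_on k (\<psi> ` (U \<inter> W)) ((\<lambda>q. h (\<phi> q)) \<circ> inv_into W \<psi>)" by (simp add: o_def)
qed

lemma smooth_nearI: "U \<in> opens A \<Longrightarrow> p \<in> U \<Longrightarrow> smooth_fun A U f \<Longrightarrow> smooth_near A p f"
  by (auto simp: smooth_near_def)

lemma smooth_nearE2:
  assumes "smooth_near A p f" "smooth_near A p h"
  obtains U where "U \<in> opens A" "p \<in> U" "smooth_fun A U f" "smooth_fun A U h"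
proof -
  obtain U V where "U \<in> opens A" "p \<in> U" "smooth_fun A U f" "V \<in> opens A" "p \<in> V" "smooth_fun A V h"
    using assms by (auto simp: smooth_near_def)
  then show ?thesis
    by (intro that[of "U \<inter> V"]) (auto intro: smooth_fun_subset simp: opens_def)
qed

lemma smooth_near_const: "p \<in> mcarrier A \<Longrightarrow> smooth_near A p (\<lambda>q. a)"
  using mcarrier_in_opens smooth_fun_const[OF open_mcarrier] by (auto intro: smooth_nearI)

lemma smooth_near_add:
  "smooth_near A p f \<Longrightarrow> smooth_near A p h \<Longrightarrow> smooth_near A p (\<lambda>q. f q + h q)"
  by (erule (1) smooth_nearE2) (auto intro!: smooth_nearI smooth_fun_add simp: opens_def)

lemma smooth_near_mult:
  "smooth_near A p f \<Longrightarrow> smooth_near A p h \<Longrightarrow> smooth_near A p (\<lambda>q. f q * h q)"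
  by (erule (1) smooth_nearE2) (auto intro!: smooth_nearI smooth_fun_mult simp: opens_def)

lemma smooth_near_sum:
  "p \<in> mcarrier A \<Longrightarrow> (\<And>i. i \<in> I \<Longrightarrow> smooth_near A p (f i)) \<Longrightarrow> smooth_near A p (\<lambda>q. \<Sum>i\<in>I. f i q)"
  by (induction I rule: infinite_finite_induct) (auto intro: smooth_near_const smooth_near_add)

lemma smooth_near_carrier: "smooth_near A p f \<Longrightarrow> p \<in> mcarrier A"
  by (auto simp: smooth_near_def opens_def)

lemma smooth_near_cong:
  assumes "\<forall>\<^sub>F q in nhds p. f q = h q" "smooth_near A p f"
  shows "smooth_near A p h"
proof -
  obtain S where S: "open S" "p \<in> S" "\<And>q. q \<in> S \<Longrightarrow> f q = h q"
    using assms(1) by (auto simp: eventually_nhds)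
  obtain U where U: "U \<in> opens A" "p \<in> U" "smooth_fun A U f"
    using assms(2) by (auto simp: smooth_near_def)
  have "smooth_fun A (U \<inter> S) h"
    using smooth_fun_cong[of "U \<inter> S" f h] S U smooth_fun_subset[OF U(3), of "U \<inter> S"]
    by (auto simp: opens_def)
  then show ?thesis using S U by (auto intro!: smooth_nearI[of "U \<inter> S"] opens_Int)
qed

lemma tangentD:
  assumes "v \<in> tangent_space A p"
  shows "\<And>f. \<not> smooth_near A p f \<Longrightarrow> v f = 0"
    and "\<And>f h. \<forall>\<^sub>F q in nhds p. f q = h q \<Longrightarrow> v f = v h"
    and "\<And>f h. smooth_near A p f \<Longrightarrow> smooth_near A p h \<Longrightarrow> v (\<lambda>q. f q + h q) = v f + v h"
    and "\<And>f h. smooth_near A p f \<Longrightarrow> smooth_near A p h \<Longrightarrow> v (\<lambda>q. f q * h q) = f p * v h + h p * v f"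
    and "\<And>f a. smooth_near A p f \<Longrightarrow> v (\<lambda>q. a * f q) = a * v f"
  using assms by (auto simp: tangent_space_def)

lemma tangent_cong:
  assumes "v \<in> tangent_space A p" "open U" "p \<in> U" "\<And>q. q \<in> U \<Longrightarrow> f q = h q"
  shows "v f = v h"
  using assms by (intro tangentD(2)[OF assms(1)]) (auto simp: eventually_nhds)

text \<open>The Leibniz rule applied to \<open>1 = 1 \<cdot> 1\<close>, and homogeneity.\<close>

lemma tangent_const:
  assumes "v \<in> tangent_space A p" "p \<in> mcarrier A"
  shows "v (\<lambda>q. a) = 0"
proof -
  have "v (\<lambda>q. 1 * 1) = 1 * v (\<lambda>q. 1) + 1 * v (\<lambda>q. 1)"
    by (rule tangentD(4)[OF assms(1)]) (use assms(2) smooth_near_const in auto)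
  then have "v (\<lambda>q. 1) = 0" by simp
  moreover have "v (\<lambda>q. a * 1) = a * v (\<lambda>q. 1)"
    by (rule tangentD(5)[OF assms(1)]) (use assms(2) smooth_near_const in auto)
  ultimately show ?thesis by simp
qed

lemma tangent_sum_fun:
  assumes "v \<in> tangent_space A p" "p \<in> mcarrier A" "\<And>i. i \<in> I \<Longrightarrow> smooth_near A p (f i)"
  shows "v (\<lambda>q. \<Sum>i\<in>I. f i q) = (\<Sum>i\<in>I. v (f i))"
  using assms(3)
proof (induction I rule: infinite_finite_induct)
  case (insert i I)
  then show ?case
    using tangentD(3)[OF assms(1), of "f i" "\<lambda>q. \<Sum>i\<in>I. f i q"] smooth_near_sum[OF assms(2), of I f] by simp
qed (use assms tangent_const in auto)

lemma tangent_zero: "0 \<in> tangent_space A p"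
  by (auto simp: tangent_space_def)

lemma tangent_add: "u \<in> tangent_space A p \<Longrightarrow> v \<in> tangent_space A p \<Longrightarrow> u + v \<in> tangent_space A p"
  unfolding tangent_space_def by (auto simp: algebra_simps)

lemma tangent_scale: "u \<in> tangent_space A p \<Longrightarrow> tscale a u \<in> tangent_space A p"
  unfolding tangent_space_def by (auto simp: algebra_simps tscale_def)

lemma diff_eq_add_tscale: "u - v = u + tscale (-1) v"
  by (auto simp: tscale_def fun_eq_iff)

lemma tangent_diff: "u \<in> tangent_space A p \<Longrightarrow> v \<in> tangent_space A p \<Longrightarrow> u - v \<in> tangent_space A p"
  unfolding diff_eq_add_tscale by (intro tangent_add tangent_scale)

lemma vfieldsD:
  assumes "X \<in> vfields A U"
  shows "\<And>p. p \<in> U \<Longrightarrow> X p \<in> tangent_space A p"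
    and "\<And>V f. V \<in> opens A \<Longrightarrow> V \<subseteq> U \<Longrightarrow> smooth_fun A V f \<Longrightarrow> smooth_fun A V (\<lambda>p. X p f)"
  using assms by (auto simp: vfields_def)

lemma vfields_subset: "X \<in> vfields A U \<Longrightarrow> V \<subseteq> U \<Longrightarrow> X \<in> vfields A V"
  by (auto simp: vfields_def)

lemma vfields_global: "X \<in> vfields A (mcarrier A) \<Longrightarrow> U \<in> opens A \<Longrightarrow> X \<in> vfields A U"
  by (auto simp: opens_def intro: vfields_subset)

lemma vfields_cong:
  assumes "X \<in> vfields A U" "\<And>p. p \<in> U \<Longrightarrow> X p = Y p"
  shows "Y \<in> vfields A U"
  unfolding vfields_def
proof (clarify, intro conjI ballI allI impI)
  fix V f assume V: "V \<in> opens A" "V \<subseteq> U" "smooth_fun A V f"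
  then have "smooth_fun A V (\<lambda>p. X p f)" by (rule vfieldsD[OF assms(1)])
  then show "smooth_fun A V (\<lambda>p. Y p f)"
    using V assms(2) smooth_fun_cong[of V "\<lambda>p. X p f" "\<lambda>p. Y p f"] by (simp add: opens_def subset_iff)
qed (use assms vfieldsD(1) in force)

lemma vfields_zero: "0 \<in> vfields A U"
  using smooth_fun_const by (auto simp: vfields_def opens_def tangent_zero)

lemma vfields_add: "X \<in> vfields A U \<Longrightarrow> Y \<in> vfields A U \<Longrightarrow> X + Y \<in> vfields A U"
  unfolding vfields_def by (auto intro!: tangent_add smooth_fun_add simp: opens_def)

lemma vfields_fscale:
  "X \<in> vfields A U \<Longrightarrow> smooth_fun A U f \<Longrightarrow> fscale f X \<in> vfields A U"
  unfolding vfields_def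
  by (auto simp: fscale_def tangent_scale)
    (auto simp: tscale_def opens_def intro!: smooth_fun_mult intro: smooth_fun_subset)

lemma vfields_diff:
  assumes "X \<in> vfields A U" "Y \<in> vfields A U" "open U"
  shows "X - Y \<in> vfields A U"
proof -
  have "X - Y = X + fscale (\<lambda>q. - 1) Y"
    by (auto simp: fun_eq_iff fscale_def tscale_def)
  moreover have "X + fscale (\<lambda>q. - 1) Y \<in> vfields A U"
    using assms by (intro vfields_add vfields_fscale smooth_fun_const)
  ultimately show ?thesis by (simp only:)
qed

lemma vfields_sum:
  assumes "\<And>i. i \<in> I \<Longrightarrow> X i \<in> vfields A U"
  shows "(\<Sum>i\<in>I. X i) \<in> vfields A U"
  using assms by (induction I rule: infinite_finite_induct) (auto intro: vfields_zero vfields_add)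

text \<open>The coordinate field \<open>\<partial>/\<partial>x\<^sub>i\<close> of the chart \<open>\<phi>\<close>. The value 0 on functions that are not smooth near the
point is the normalisation made in \<^const>\<open>tangent_space\<close>.\<close>

definition coord_vfield :: "'a set \<Rightarrow> ('a \<Rightarrow> 'b) \<Rightarrow> 'b \<Rightarrow> 'a vfield" where
  "coord_vfield V \<phi> i q f =
     (if smooth_near A q f then frechet_derivative (f \<circ> inv_into V \<phi>) (at (\<phi> q)) i else 0)"

lemma smooth_near_chart_derivative:
  assumes "(V, \<phi>) \<in> A" "q \<in> V" "smooth_near A q f"
  shows "((f \<circ> inv_into V \<phi>) has_derivative frechet_derivative (f \<circ> inv_into V \<phi>) (at (\<phi> q))) (at (\<phi> q))"
proof -
  obtain U where U: "U \<in> opens A" "q \<in> U" "smooth_fun A U f"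
    using assms(3) by (auto simp: smooth_near_def)
  then have "smooth_on (\<phi> ` (U \<inter> V)) (f \<circ> inv_into V \<phi>)"
    using assms(1) by (auto simp: smooth_fun_def)
  then show ?thesis using U(2) assms(2) by (intro smooth_onD(1)) auto
qed

lemma coord_vfield_eq:
  assumes "(V, \<phi>) \<in> A" "q \<in> V" "smooth_near A q f"
    and "((f \<circ> inv_into V \<phi>) has_derivative D) (at (\<phi> q))"
  shows "coord_vfield V \<phi> i q f = D i"
  using assms frechet_derivative_at[OF assms(4)] by (simp add: coord_vfield_def)

lemma coord_vfield_tangent:
  assumes V: "(V, \<phi>) \<in> A" "q \<in> V"
  shows "coord_vfield V \<phi> i q \<in> tangent_space A q"
proof -
  let ?F = "\<lambda>f. f \<circ> inv_into V \<phi>"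
  let ?D = "\<lambda>f. frechet_derivative (?F f) (at (\<phi> q))"
  note D = smooth_near_chart_derivative[OF V]
  have q: "inv_into V \<phi> (\<phi> q) = q" using chart_inverse[OF V] .
  have "coord_vfield V \<phi> i q f = coord_vfield V \<phi> i q h" if ev: "\<forall>\<^sub>F q in nhds q. f q = h q" for f h
  proof (cases "smooth_near A q f")
    case True
    obtain S where S: "open S" "q \<in> S" "\<And>q. q \<in> S \<Longrightarrow> f q = h q"
      using ev by (auto simp: eventually_nhds)
    have "(?F h has_derivative ?D f) (at (\<phi> q))"
      by (rule has_derivative_transform_within_open[OF D[OF True] chart_open_map[OF V(1) S(1)]])
        (use S V chart_inverse[OF V(1)] in auto)
    then show ?thesis
      using True smooth_near_cong[OF ev] coord_vfield_eq[OF V] D by metis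
  next
    case False
    moreover have "\<not> smooth_near A q h"
      using False smooth_near_cong[where p = q and f = h and h = f] ev by (auto simp: eq_commute)
    ultimately show ?thesis by (simp add: coord_vfield_def)
  qed
  moreover have "coord_vfield V \<phi> i q (\<lambda>q. f q + h q) = coord_vfield V \<phi> i q f + coord_vfield V \<phi> i q h"
    if "smooth_near A q f" "smooth_near A q h" for f h
    using coord_vfield_eq[OF V smooth_near_add[OF that], of "\<lambda>w. ?D f w + ?D h w"]
      has_derivative_add[OF D[OF that(1)] D[OF that(2)]] that
    by (simp add: o_def coord_vfield_def)
  moreover have "coord_vfield V \<phi> i q (\<lambda>q. f q * h q) = f q * coord_vfield V \<phi> i q h + h q * coord_vfield V \<phi> i q f"
    if "smooth_near A q f" "smooth_near A q h" for f h
    using coord_vfield_eq[OF V smooth_near_mult[OF that], of "\<lambda>w. f q * ?D h w + ?D f w * h q"]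
      has_derivative_mult[OF D[OF that(1)] D[OF that(2)]] that q
    by (simp add: o_def coord_vfield_def mult.commute)
  moreover have "coord_vfield V \<phi> i q (\<lambda>q. a * f q) = a * coord_vfield V \<phi> i q f"
    if "smooth_near A q f" for f a
    using coord_vfield_eq[OF V smooth_near_mult[OF smooth_near_const that], of a "\<lambda>w. a * ?D f w"]
      has_derivative_mult_right[OF D[OF that]] that smooth_near_carrier[OF that]
    by (simp add: o_def coord_vfield_def)
  ultimately show ?thesis
    unfolding tangent_space_def by (auto simp: coord_vfield_def)
qed

lemma coord_vfield_vfields:
  assumes V: "(V, \<phi>) \<in> A"
  shows "coord_vfield V \<phi> i \<in> vfields A V"
  unfolding vfields_def
proof (clarify, intro conjI ballI allI impI)
  fix W f assume W: "W \<in> opens A" "W \<subseteq> V" "smooth_fun A W f"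
  have WV: "W \<inter> V = W" using W(2) by auto
  have "smooth_on (\<phi> ` W) (f \<circ> inv_into V \<phi>)"
    using W(3) V WV by (fastforce simp: smooth_fun_def)
  then have "smooth_fun A W (\<lambda>q. frechet_derivative (f \<circ> inv_into V \<phi>) (at (\<phi> q)) i)"
    using W WV chart_open_map[OF V, of W]
    by (intro smooth_fun_chart[OF V _ _ _ _ smooth_onD(2)]) (auto simp: opens_def)
  moreover have "smooth_near A q f" if "q \<in> W" for q
    using W that by (auto intro: smooth_nearI)
  ultimately show "smooth_fun A W (\<lambda>q. coord_vfield V \<phi> i q f)"
    using W(1) by (subst smooth_fun_cong) (auto simp: opens_def coord_vfield_def)
qed (use coord_vfield_tangent[OF V] in auto)

lemma coordinate_smooth_near:
  assumes "(V, \<phi>) \<in> A" "p \<in> V"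
  shows "smooth_near A p (\<lambda>q. \<phi> q \<bullet> i)"
proof -
  have "smooth_on UNIV (\<lambda>y::'b. y \<bullet> i)"
    unfolding smooth_on_def
  proof
    fix k
    show "Ck_on k UNIV (\<lambda>y::'b. y \<bullet> i)"
    proof (cases k)
      case (Suc m)
      show ?thesis unfolding Suc
        by (rule Ck_on_SucI[where f' = "\<lambda>x w. w \<bullet> i"])
          (auto intro!: Ck_on_const derivative_eq_intros)
    qed (auto intro!: continuous_intros)
  qed
  then show ?thesis
    using chart_homeomorphism[OF assms(1)] assms
    by (intro smooth_nearI[of V] smooth_fun_chart[OF assms(1), of V UNIV "\<lambda>y. y \<bullet> i"]) (auto simp: opens_def)
qed

lemma coord_vfield_coordinate:
  assumes "(V, \<phi>) \<in> A" "p \<in> V"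
  shows "coord_vfield V \<phi> j p (\<lambda>q. \<phi> q \<bullet> i) = j \<bullet> i"
proof (rule coord_vfield_eq[OF assms coordinate_smooth_near[OF assms]])
  note V = chart_homeomorphism[OF assms(1)]
  show "((\<lambda>q. \<phi> q \<bullet> i) \<circ> inv_into V \<phi> has_derivative (\<lambda>w. w \<bullet> i)) (at (\<phi> p))"
    by (rule has_derivative_transform_within_open[where f = "\<lambda>y. y \<bullet> i", OF _ V(4)])
      (use assms V in \<open>auto intro!: derivative_eq_intros simp: f_inv_into_f\<close>)
qed

text \<open>Near \<open>p\<close>, Hadamard's lemma writes \<open>f\<close> as \<open>f p + \<Sum>\<^sub>i (x\<^sub>i - x\<^sub>i p) h\<^sub>i\<close>. A derivation at \<open>p\<close> kills the constants,
and the Leibniz rule leaves \<open>\<Sum>\<^sub>i h\<^sub>i p \<cdot> v x\<^sub>i\<close>. The coefficients do not depend on the derivation, so a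
derivation is determined by its values on the coordinates.\<close>

lemma tangent_in_coordinates:
  assumes V: "(V, \<phi>) \<in> A" "p \<in> V" and f: "smooth_near A p f"
  obtains a where "\<And>v. v \<in> tangent_space A p \<Longrightarrow> v f = (\<Sum>i\<in>Basis. a i * v (\<lambda>q. \<phi> q \<bullet> i))"
proof -
  note Vh = chart_homeomorphism[OF V(1)]
  have p: "p \<in> mcarrier A" using Vh V by auto
  obtain U where U: "U \<in> opens A" "p \<in> U" "smooth_fun A U f"
    using f by (auto simp: smooth_near_def)
  have "open (\<phi> ` (U \<inter> V))" "\<phi> p \<in> \<phi> ` (U \<inter> V)"
    using chart_open_map[OF V(1)] U V by (auto simp: opens_def)
  then obtain r where r: "r > 0" "ball (\<phi> p) r \<subseteq> \<phi> ` (U \<inter> V)"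
    using open_contains_ball by metis
  have "smooth_on (\<phi> ` (U \<inter> V)) (f \<circ> inv_into V \<phi>)"
    using U V by (auto simp: smooth_fun_def)
  then have "smooth_on (ball (\<phi> p) r) (f \<circ> inv_into V \<phi>)"
    using r by (auto simp: smooth_on_def intro: Ck_on_subset)
  then obtain h where h: "\<And>i. smooth_on (ball (\<phi> p) r) (h i)"
    and eq: "\<And>x. x \<in> ball (\<phi> p) r \<Longrightarrow> (f \<circ> inv_into V \<phi>) x =
      (f \<circ> inv_into V \<phi>) (\<phi> p) + (\<Sum>i\<in>Basis. ((x \<bullet> i) - (\<phi> p \<bullet> i)) * h i x)"
    by (rule hadamard_expansion) blast
  define N where "N = V \<inter> \<phi> -` ball (\<phi> p) r"
  have N: "open N" "p \<in> N" "N \<subseteq> V" "N \<in> opens A"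
    using continuous_open_preimage[OF homeomorphism_cont1[OF Vh(3)] Vh(1), of "ball (\<phi> p) r"] r V Vh
    by (auto simp: N_def opens_def)
  have hN: "smooth_near A p (\<lambda>q. h i (\<phi> q))" for i
    by (rule smooth_nearI[OF N(4,2) smooth_fun_chart[OF V(1) N(1,3) open_ball _ h]]) (auto simp: N_def)
  have x: "smooth_near A p (\<lambda>q. (\<phi> q \<bullet> i) + (- (\<phi> p \<bullet> i)))" for i
    by (intro smooth_near_add coordinate_smooth_near[OF V] smooth_near_const p)
  have "v f = (\<Sum>i\<in>Basis. h i (\<phi> p) * v (\<lambda>q. \<phi> q \<bullet> i))" if v: "v \<in> tangent_space A p" for v
  proof -
    have "v f = v (\<lambda>q. f p + (\<Sum>i\<in>Basis. ((\<phi> q \<bullet> i) + (- (\<phi> p \<bullet> i))) * h i (\<phi> q)))"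
    proof (rule tangent_cong[OF v N(1,2)])
      fix q assume "q \<in> N"
      then show "f q = f p + (\<Sum>i\<in>Basis. ((\<phi> q \<bullet> i) + (- (\<phi> p \<bullet> i))) * h i (\<phi> q))"
        using eq[of "\<phi> q"] chart_inverse[OF V(1)] V by (auto simp: N_def)
    qed
    also have "\<dots> = v (\<lambda>q. f p) + (\<Sum>i\<in>Basis. v (\<lambda>q. ((\<phi> q \<bullet> i) + (- (\<phi> p \<bullet> i))) * h i (\<phi> q)))"
      by (subst tangentD(3)[OF v] tangent_sum_fun[OF v p];
          (intro smooth_near_const p smooth_near_sum smooth_near_mult x hN refl)?)+
    also have "\<dots> = (\<Sum>i\<in>Basis. h i (\<phi> p) * v (\<lambda>q. \<phi> q \<bullet> i))"
    proof -
      have "v (\<lambda>q. ((\<phi> q \<bullet> i) + (- (\<phi> p \<bullet> i))) * h i (\<phi> q)) = h i (\<phi> p) * v (\<lambda>q. \<phi> q \<bullet> i)" for i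
        using tangentD(4)[OF v x[of i] hN[of i]] tangent_const[OF v p, of "- (\<phi> p \<bullet> i)"]
          tangentD(3)[OF v coordinate_smooth_near[OF V, of i] smooth_near_const[OF p, of "- (\<phi> p \<bullet> i)"]]
        by simp
      then show ?thesis by (simp add: tangent_const[OF v p])
    qed
    finally show ?thesis .
  qed
  then show ?thesis by (rule that)
qed

text \<open>The field with constant coefficients \<open>v x\<^sub>i\<close> in a chart agrees with \<open>v\<close> on the coordinates, hence
everywhere. This turns identities between local vector fields into identities between tangent
vectors at a point, and lets nondegeneracy of a metric be tested on vector fields.\<close>

lemma tangent_extends:
  assumes U: "U \<in> opens A" "p \<in> U" and v: "v \<in> tangent_space A p"
  obtains V W where "V \<in> opens A" "V \<subseteq> U" "p \<in> V" "W \<in> vfields A V" "W p = v"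
proof -
  have "p \<in> mcarrier A" using U by (auto simp: opens_def)
  then obtain V \<phi> where V: "(V, \<phi>) \<in> A" "p \<in> V" by (rule chart_exists)
  note Vh = chart_homeomorphism[OF V(1)]
  define W where "W = (\<Sum>j\<in>Basis. fscale (\<lambda>q. v (\<lambda>q. \<phi> q \<bullet> j)) (coord_vfield V \<phi> j))"
  have W: "W \<in> vfields A V"
    unfolding W_def by (intro vfields_sum vfields_fscale coord_vfield_vfields V smooth_fun_const Vh)
  have Wp: "W p \<in> tangent_space A p" using vfieldsD(1)[OF W V(2)] .
  have coord: "W p (\<lambda>q. \<phi> q \<bullet> i) = v (\<lambda>q. \<phi> q \<bullet> i)" if "i \<in> Basis" for i
  proof -
    have "W p (\<lambda>q. \<phi> q \<bullet> i) = (\<Sum>j\<in>Basis. v (\<lambda>q. \<phi> q \<bullet> j) * (j \<bullet> i))"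
      unfolding W_def sum_vfield_apply by (simp add: fscale_def tscale_def coord_vfield_coordinate[OF V])
    also have "\<dots> = v (\<lambda>q. \<phi> q \<bullet> i)"
      using that by (simp add: inner_Basis if_distrib cong: if_cong)
    finally show ?thesis .
  qed
  have "W p f = v f" for f
  proof (cases "smooth_near A p f")
    case True
    obtain a where "\<And>v. v \<in> tangent_space A p \<Longrightarrow> v f = (\<Sum>i\<in>Basis. a i * v (\<lambda>q. \<phi> q \<bullet> i))"
      by (rule tangent_in_coordinates[OF V True]) blast
    from this[OF v] this[OF Wp] show ?thesis using coord by simp
  qed (simp add: tangentD(1)[OF v] tangentD(1)[OF Wp])
  then have "W p = v" by auto
  then show ?thesis
    using that[of "U \<inter> V" W] opens_Int[OF U(1) Vh(1)] U V vfields_subset[OF W, of "U \<inter> V"] by auto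
qed

end

section \<open>Levi-Civita and associated connection of an F-manifold with Killing unit\<close>

lemma mult_apply: "mult c X Y p = c p (X p) (Y p)"
  by (simp add: mult_def)

text \<open>Instantiating the nested bounded quantifiers of the definitions of connections, products, metrics and
F-manifolds once and for all keeps the search in later proofs small.\<close>

lemma is_connectionD:
  assumes "is_connection A nabla" "U \<in> opens A"
  shows "\<And>X Y. X \<in> vfields A U \<Longrightarrow> Y \<in> vfields A U \<Longrightarrow> nabla X Y \<in> vfields A U"
    and "\<And>X X' Y Y' p. X \<in> vfields A U \<Longrightarrow> X' \<in> vfields A U \<Longrightarrow> Y \<in> vfields A U \<Longrightarrow> Y' \<in> vfields A U \<Longrightarrow>
      (\<And>q. q \<in> U \<Longrightarrow> X q = X' q \<and> Y q = Y' q) \<Longrightarrow> p \<in> U \<Longrightarrow> nabla X Y p = nabla X' Y' p"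
    and "\<And>X Y Z p. X \<in> vfields A U \<Longrightarrow> Y \<in> vfields A U \<Longrightarrow> Z \<in> vfields A U \<Longrightarrow> p \<in> U \<Longrightarrow>
      nabla (X + Y) Z p = nabla X Z p + nabla Y Z p \<and> nabla X (Y + Z) p = nabla X Y p + nabla X Z p"
    and "\<And>X Y f p. X \<in> vfields A U \<Longrightarrow> Y \<in> vfields A U \<Longrightarrow> smooth_fun A U f \<Longrightarrow> p \<in> U \<Longrightarrow>
      nabla (fscale f X) Y p = fscale f (nabla X Y) p \<and>
      nabla X (fscale f Y) p = fscale f (nabla X Y) p + fscale (act X f) Y p"
proof -
  note * = bspec[OF assms(1)[unfolded is_connection_def] assms(2)]
  note ** = *[THEN conjunct2] note *** = **[THEN conjunct2]
  show "\<And>X Y. X \<in> vfields A U \<Longrightarrow> Y \<in> vfields A U \<Longrightarrow> nabla X Y \<in> vfields A U"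
    using *[THEN conjunct1] by blast
  show "\<And>X X' Y Y' p. X \<in> vfields A U \<Longrightarrow> X' \<in> vfields A U \<Longrightarrow> Y \<in> vfields A U \<Longrightarrow> Y' \<in> vfields A U \<Longrightarrow>
      (\<And>q. q \<in> U \<Longrightarrow> X q = X' q \<and> Y q = Y' q) \<Longrightarrow> p \<in> U \<Longrightarrow> nabla X Y p = nabla X' Y' p"
    by (rule **[THEN conjunct1, rule_format]) auto
  show "\<And>X Y Z p. X \<in> vfields A U \<Longrightarrow> Y \<in> vfields A U \<Longrightarrow> Z \<in> vfields A U \<Longrightarrow> p \<in> U \<Longrightarrow>
      nabla (X + Y) Z p = nabla X Z p + nabla Y Z p \<and> nabla X (Y + Z) p = nabla X Y p + nabla X Z p"
    using ***[THEN conjunct1] by simp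
  show "\<And>X Y f p. X \<in> vfields A U \<Longrightarrow> Y \<in> vfields A U \<Longrightarrow> smooth_fun A U f \<Longrightarrow> p \<in> U \<Longrightarrow>
      nabla (fscale f X) Y p = fscale f (nabla X Y) p \<and>
      nabla X (fscale f Y) p = fscale f (nabla X Y) p + fscale (act X f) Y p"
    using ***[THEN conjunct2] by simp
qed

lemma is_productD:
  assumes "is_product A c"
  shows "\<And>p u v. p \<in> mcarrier A \<Longrightarrow> u \<in> tangent_space A p \<Longrightarrow> v \<in> tangent_space A p \<Longrightarrow>
      c p u v \<in> tangent_space A p"
    and "\<And>p u v w. p \<in> mcarrier A \<Longrightarrow> u \<in> tangent_space A p \<Longrightarrow> v \<in> tangent_space A p \<Longrightarrow>
      w \<in> tangent_space A p \<Longrightarrow> c p u (v + w) = c p u v + c p u w"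
    and "\<And>p u v a. p \<in> mcarrier A \<Longrightarrow> u \<in> tangent_space A p \<Longrightarrow> v \<in> tangent_space A p \<Longrightarrow>
      c p u (tscale a v) = tscale a (c p u v)"
    and "\<And>U X Y. U \<in> opens A \<Longrightarrow> X \<in> vfields A U \<Longrightarrow> Y \<in> vfields A U \<Longrightarrow> mult c X Y \<in> vfields A U"
proof -
  note * = assms[unfolded is_product_def]
  note ** = *[THEN conjunct1, THEN bspec, THEN bspec, THEN bspec]
  show "\<And>p u v. p \<in> mcarrier A \<Longrightarrow> u \<in> tangent_space A p \<Longrightarrow> v \<in> tangent_space A p \<Longrightarrow>
      c p u v \<in> tangent_space A p"
    by (rule **[THEN conjunct1])
  show "\<And>p u v w. p \<in> mcarrier A \<Longrightarrow> u \<in> tangent_space A p \<Longrightarrow> v \<in> tangent_space A p \<Longrightarrow>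
      w \<in> tangent_space A p \<Longrightarrow> c p u (v + w) = c p u v + c p u w"
    by (rule **[THEN conjunct2, THEN conjunct1, THEN bspec, THEN conjunct2])
  show "\<And>p u v a. p \<in> mcarrier A \<Longrightarrow> u \<in> tangent_space A p \<Longrightarrow> v \<in> tangent_space A p \<Longrightarrow>
      c p u (tscale a v) = tscale a (c p u v)"
    by (rule **[THEN conjunct2, THEN conjunct2, THEN spec, THEN conjunct2])
  show "\<And>U X Y. U \<in> opens A \<Longrightarrow> X \<in> vfields A U \<Longrightarrow> Y \<in> vfields A U \<Longrightarrow> mult c X Y \<in> vfields A U"
    by (rule *[THEN conjunct2, THEN bspec, THEN bspec, THEN bspec])
qed

lemma is_metricD:
  assumes "is_metric A g"
  shows "\<And>p u v. p \<in> mcarrier A \<Longrightarrow> u \<in> tangent_space A p \<Longrightarrow> v \<in> tangent_space A p \<Longrightarrow> g p u v = g p v u"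
    and "\<And>p u v w. p \<in> mcarrier A \<Longrightarrow> u \<in> tangent_space A p \<Longrightarrow> v \<in> tangent_space A p \<Longrightarrow>
      w \<in> tangent_space A p \<Longrightarrow> g p (u + w) v = g p u v + g p w v"
    and "\<And>p u v a. p \<in> mcarrier A \<Longrightarrow> u \<in> tangent_space A p \<Longrightarrow> v \<in> tangent_space A p \<Longrightarrow>
      g p (tscale a u) v = a * g p u v"
    and "\<And>p u. p \<in> mcarrier A \<Longrightarrow> u \<in> tangent_space A p \<Longrightarrow>
      (\<And>v. v \<in> tangent_space A p \<Longrightarrow> g p u v = 0) \<Longrightarrow> u = 0"
    and "\<And>U X Y. U \<in> opens A \<Longrightarrow> X \<in> vfields A U \<Longrightarrow> Y \<in> vfields A U \<Longrightarrow> smooth_fun A U (pairing g X Y)"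
proof -
  note * = assms[unfolded is_metric_def]
  note ** = *[THEN conjunct1, THEN bspec, THEN bspec, THEN bspec]
  show "\<And>p u v. p \<in> mcarrier A \<Longrightarrow> u \<in> tangent_space A p \<Longrightarrow> v \<in> tangent_space A p \<Longrightarrow> g p u v = g p v u"
    by (rule **[THEN conjunct1])
  show "\<And>p u v w. p \<in> mcarrier A \<Longrightarrow> u \<in> tangent_space A p \<Longrightarrow> v \<in> tangent_space A p \<Longrightarrow>
      w \<in> tangent_space A p \<Longrightarrow> g p (u + w) v = g p u v + g p w v"
    by (rule **[THEN conjunct2, THEN conjunct1, THEN bspec])
  show "\<And>p u v a. p \<in> mcarrier A \<Longrightarrow> u \<in> tangent_space A p \<Longrightarrow> v \<in> tangent_space A p \<Longrightarrow>
      g p (tscale a u) v = a * g p u v"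
    by (rule **[THEN conjunct2, THEN conjunct2, THEN spec])
  show "\<And>p u. p \<in> mcarrier A \<Longrightarrow> u \<in> tangent_space A p \<Longrightarrow>
      (\<And>v. v \<in> tangent_space A p \<Longrightarrow> g p u v = 0) \<Longrightarrow> u = 0"
    using *[THEN conjunct2, THEN conjunct1] by blast
  show "\<And>U X Y. U \<in> opens A \<Longrightarrow> X \<in> vfields A U \<Longrightarrow> Y \<in> vfields A U \<Longrightarrow> smooth_fun A U (pairing g X Y)"
    by (rule *[THEN conjunct2, THEN conjunct2, THEN bspec, THEN bspec, THEN bspec])
qed

lemma F_manifoldD:
  assumes "F_manifold A c e"
  shows "smooth_atlas A" and "is_product A c" and "e \<in> vfields A (mcarrier A)"
    and "\<And>U X Y Z p. U \<in> opens A \<Longrightarrow> X \<in> vfields A U \<Longrightarrow> Y \<in> vfields A U \<Longrightarrow> Z \<in> vfields A U \<Longrightarrow> p \<in> U \<Longrightarrow>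
      mult c X Y p = mult c Y X p \<and> mult c (mult c X Y) Z p = mult c X (mult c Y Z) p \<and> mult c e X p = X p"
    and "\<And>U X Y Z W p. U \<in> opens A \<Longrightarrow> X \<in> vfields A U \<Longrightarrow> Y \<in> vfields A U \<Longrightarrow> Z \<in> vfields A U \<Longrightarrow>
      W \<in> vfields A U \<Longrightarrow> p \<in> U \<Longrightarrow> lie_product A c (mult c X Y) Z W p =
        c p (X p) (lie_product A c Y Z W p) + c p (Y p) (lie_product A c X Z W p)"
proof -
  note * = assms[unfolded F_manifold_def]
  show "smooth_atlas A" "is_product A c" "e \<in> vfields A (mcarrier A)"
    by (rule *[THEN conjunct1] *[THEN conjunct2, THEN conjunct1]
        *[THEN conjunct2, THEN conjunct2, THEN conjunct1])+
  note ** = *[THEN conjunct2, THEN conjunct2, THEN conjunct2]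
  show "\<And>U X Y Z p. U \<in> opens A \<Longrightarrow> X \<in> vfields A U \<Longrightarrow> Y \<in> vfields A U \<Longrightarrow> Z \<in> vfields A U \<Longrightarrow> p \<in> U \<Longrightarrow>
      mult c X Y p = mult c Y X p \<and> mult c (mult c X Y) Z p = mult c X (mult c Y Z) p \<and> mult c e X p = X p"
    by (rule **[THEN conjunct1, THEN bspec, THEN bspec, THEN bspec, THEN bspec, THEN bspec])
  show "\<And>U X Y Z W p. U \<in> opens A \<Longrightarrow> X \<in> vfields A U \<Longrightarrow> Y \<in> vfields A U \<Longrightarrow> Z \<in> vfields A U \<Longrightarrow>
      W \<in> vfields A U \<Longrightarrow> p \<in> U \<Longrightarrow> lie_product A c (mult c X Y) Z W p =
        c p (X p) (lie_product A c Y Z W p) + c p (Y p) (lie_product A c X Z W p)"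
    using **[THEN conjunct2, THEN bspec, THEN bspec, THEN bspec, THEN bspec, THEN bspec, THEN bspec]
    by (simp add: mult_def)
qed

text \<open>An F-manifold with invariant metric and Killing unit field, with the Levi-Civita connection \<open>lc\<close>
(\<open>D\<close> in the comments).\<close>

locale riemannian_F_calculus = smooth_manifold A
  for A :: "('a::{t2_space,second_countable_topology}, 'b::euclidean_space) chart set" +
  fixes c :: "'a product" and g :: "'a bilinear_form" and e :: "'a vfield" and lc :: "'a connection"
  assumes F: "F_manifold A c e" and metric: "is_metric A g"
    and invariant: "\<forall>U\<in>opens A. \<forall>X\<in>vfields A U. \<forall>Y\<in>vfields A U. \<forall>Z\<in>vfields A U. \<forall>p\<in>U.
        pairing g (mult c X Y) Z p = pairing g X (mult c Y Z) p"
    and lc: "levi_civita A g lc"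
    and killing: "\<forall>U\<in>opens A. \<forall>X\<in>vfields A U. \<forall>Y\<in>vfields A U. \<forall>p\<in>U. lie_form A g e X Y p = 0"
begin

lemma opensD: "U \<in> opens A \<Longrightarrow> p \<in> U \<Longrightarrow> p \<in> mcarrier A" "U \<in> opens A \<Longrightarrow> open U"
  by (auto simp: opens_def)

lemma vf_tangent: "X \<in> vfields A U \<Longrightarrow> p \<in> U \<Longrightarrow> X p \<in> tangent_space A p"
  by (rule vfieldsD)

lemma vf_mult: "U \<in> opens A \<Longrightarrow> X \<in> vfields A U \<Longrightarrow> Y \<in> vfields A U \<Longrightarrow> mult c X Y \<in> vfields A U"
  by (rule is_productD(4)[OF F_manifoldD(2)[OF F]])

lemma vf_unit: "U \<in> opens A \<Longrightarrow> e \<in> vfields A U"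
  by (rule vfields_global[OF F_manifoldD(3)[OF F]])

lemma lc_connection: "is_connection A lc"
  using lc by (simp add: levi_civita_def)

lemma vf_lc: "U \<in> opens A \<Longrightarrow> X \<in> vfields A U \<Longrightarrow> Y \<in> vfields A U \<Longrightarrow> lc X Y \<in> vfields A U"
  by (rule is_connectionD(1)[OF lc_connection])

lemma lc_cong:
  assumes "U \<in> opens A" "X \<in> vfields A U" "Y \<in> vfields A U" "X' \<in> vfields A U" "Y' \<in> vfields A U"
    and "\<And>q. q \<in> U \<Longrightarrow> X q = X' q" "\<And>q. q \<in> U \<Longrightarrow> Y q = Y' q" "p \<in> U"
  shows "lc X Y p = lc X' Y' p"
  by (rule is_connectionD(2)[OF lc_connection assms(1,2,4,3,5) _ assms(8)]) (use assms(6,7) in blast)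

lemma tangent_extends3:
  assumes "U \<in> opens A" "p \<in> U"
    and "u \<in> tangent_space A p" "v \<in> tangent_space A p" "w \<in> tangent_space A p"
  obtains V X Y Z where "V \<in> opens A" "p \<in> V" "X \<in> vfields A V" "Y \<in> vfields A V" "Z \<in> vfields A V"
    "X p = u" "Y p = v" "Z p = w"
proof -
  obtain V1 X where 1: "V1 \<in> opens A" "p \<in> V1" "X \<in> vfields A V1" "X p = u"
    using tangent_extends[OF assms(1,2,3)] by metis
  obtain V2 Y where 2: "V2 \<in> opens A" "V2 \<subseteq> V1" "p \<in> V2" "Y \<in> vfields A V2" "Y p = v"
    using tangent_extends[OF 1(1,2) assms(4)] by metis
  obtain V3 Z where 3: "V3 \<in> opens A" "V3 \<subseteq> V2" "p \<in> V3" "Z \<in> vfields A V3" "Z p = w"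
    using tangent_extends[OF 2(1,3) assms(5)] by metis
  show ?thesis
    by (rule that[of V3 X Y Z]) (use 1 2 3 in \<open>auto intro: vfields_subset\<close>)
qed

text \<open>The axioms of the product and of the metric, read off at a single point: the given tangent vectors
  are extended to local vector fields.\<close>

context
  fixes p :: 'a
  assumes p: "p \<in> mcarrier A"
begin

lemmas c_tangent = is_productD(1)[OF F_manifoldD(2)[OF F] p]
  and c_add_right = is_productD(2)[OF F_manifoldD(2)[OF F] p]
  and c_scale_right = is_productD(3)[OF F_manifoldD(2)[OF F] p]

lemma c_diff_right:
  "u \<in> tangent_space A p \<Longrightarrow> v \<in> tangent_space A p \<Longrightarrow> w \<in> tangent_space A p \<Longrightarrow>
    c p u (v - w) = c p u v - c p u w"
  by (simp only: diff_eq_add_tscale c_add_right c_scale_right tangent_scale)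

lemma c_commute:
  assumes "u \<in> tangent_space A p" "v \<in> tangent_space A p"
  shows "c p u v = c p v u"
proof -
  obtain V X Y Z where V: "V \<in> opens A" "p \<in> V" "X \<in> vfields A V" "Y \<in> vfields A V" "Z \<in> vfields A V"
    "X p = u" "Y p = v" "Z p = u"
    using tangent_extends3[OF mcarrier_in_opens p assms assms(1)] by metis
  then have "mult c X Y p = mult c Y X p" using F_manifoldD(4)[OF F] by blast
  then show ?thesis using V by (simp add: mult_def)
qed

lemma c_assoc:
  assumes "u \<in> tangent_space A p" "v \<in> tangent_space A p" "w \<in> tangent_space A p"
  shows "c p (c p u v) w = c p u (c p v w)"
proof -
  obtain V X Y Z where V: "V \<in> opens A" "p \<in> V" "X \<in> vfields A V" "Y \<in> vfields A V" "Z \<in> vfields A V"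
    "X p = u" "Y p = v" "Z p = w"
    using tangent_extends3[OF mcarrier_in_opens p assms] by metis
  then have "mult c (mult c X Y) Z p = mult c X (mult c Y Z) p"
    using F_manifoldD(4)[OF F] by blast
  then show ?thesis using V by (simp add: mult_def)
qed

lemma c_unit:
  assumes "u \<in> tangent_space A p"
  shows "c p (e p) u = u" "c p u (e p) = u"
proof -
  obtain V X Y Z where V: "V \<in> opens A" "p \<in> V" "X \<in> vfields A V" "Y \<in> vfields A V" "Z \<in> vfields A V"
    "X p = u" "Y p = u" "Z p = u"
    using tangent_extends3[OF mcarrier_in_opens p assms assms assms] by metis
  then have "mult c e X p = X p" using F_manifoldD(4)[OF F] by blast
  then show 1: "c p (e p) u = u" using V by (simp add: mult_def)
  show "c p u (e p) = u"
    using 1 c_commute[OF assms vf_tangent[OF vf_unit[OF mcarrier_in_opens] p]] by simp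
qed

lemma g_invariant:
  assumes "u \<in> tangent_space A p" "v \<in> tangent_space A p" "w \<in> tangent_space A p"
  shows "g p (c p u v) w = g p u (c p v w)"
proof -
  obtain V X Y Z where V: "V \<in> opens A" "p \<in> V" "X \<in> vfields A V" "Y \<in> vfields A V" "Z \<in> vfields A V"
    "X p = u" "Y p = v" "Z p = w"
    using tangent_extends3[OF mcarrier_in_opens p assms] by metis
  then have "pairing g (mult c X Y) Z p = pairing g X (mult c Y Z) p"
    using invariant by blast
  then show ?thesis using V by (simp add: mult_def pairing_def)
qed

lemmas g_commute = is_metricD(1)[OF metric p]

lemma g_add_left:
  "u \<in> tangent_space A p \<Longrightarrow> v \<in> tangent_space A p \<Longrightarrow> w \<in> tangent_space A p \<Longrightarrow>
    g p (u + v) w = g p u w + g p v w"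
  by (rule is_metricD(2)[OF metric p])

lemmas g_scale_left = is_metricD(3)[OF metric p]

lemma g_diff_left:
  "u \<in> tangent_space A p \<Longrightarrow> v \<in> tangent_space A p \<Longrightarrow> w \<in> tangent_space A p \<Longrightarrow>
    g p (u - v) w = g p u w - g p v w"
  by (simp add: diff_eq_add_tscale g_add_left g_scale_left tangent_scale)

lemma g_nondegenerate:
  assumes "u \<in> tangent_space A p" "v \<in> tangent_space A p"
    and "\<And>w. w \<in> tangent_space A p \<Longrightarrow> g p u w = g p v w"
  shows "u = v"
proof -
  have "u - v = 0"
    by (rule is_metricD(4)[OF metric p]) (use assms in \<open>auto simp: tangent_diff g_diff_left\<close>)
  then show ?thesis by simp
qed

end

lemma lc_metric:
  assumes U: "U \<in> opens A" "p \<in> U" and X: "X \<in> vfields A U" "Y \<in> vfields A U" "Z \<in> vfields A U"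
  shows "X p (pairing g Y Z) = g p (lc X Y p) (Z p) + g p (lc X Z p) (Y p)"
proof -
  have "cov_deriv_form lc g X Y Z p = 0"
    using lc U X unfolding levi_civita_def by blast
  moreover have "g p (Y p) (lc X Z p) = g p (lc X Z p) (Y p)"
    by (intro g_commute[OF opensD(1)[OF U]] vf_tangent[OF _ U(2)] vf_lc[OF U(1)] X)
  ultimately show ?thesis by (simp add: cov_deriv_form_def act_def pairing_def)
qed

lemma lie_bracket_lc:
  assumes U: "U \<in> opens A" "p \<in> U" and X: "X \<in> vfields A U" "Y \<in> vfields A U"
  shows "lie_bracket A X Y p = lc X Y p - lc Y X p"
proof -
  have "(lc X Y - lc Y X) p = lie_bracket A X Y p"
    using lc U X unfolding levi_civita_def torsionless_def by blast
  then show ?thesis by simp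
qed

text \<open>The bracket is a difference of two covariant derivatives, which spares a direct proof that it is
a smooth derivation.\<close>

lemma vf_lie_bracket:
  assumes U: "U \<in> opens A" and X: "X \<in> vfields A U" "Y \<in> vfields A U"
  shows "lie_bracket A X Y \<in> vfields A U"
  by (rule vfields_cong[OF vfields_diff[OF vf_lc vf_lc opensD(2)]])
    (use assms lie_bracket_lc[OF U _ X] in auto)

text \<open>The Killing equation \<open>\<L>\<^sub>e g = 0\<close> says that the 2-form \<open>\<omega>(X, Y) = g(D\<^sub>X e, Y)\<close> is antisymmetric.\<close>

lemma unit_killing:
  assumes U: "U \<in> opens A" "p \<in> U" and X: "X \<in> vfields A U" "Y \<in> vfields A U"
  shows "g p (lc X e p) (Y p) = - g p (lc Y e p) (X p)"
proof -
  note p = opensD(1)[OF U]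
  note vf = X vf_unit[OF U(1)]
  note T = vf_tangent[OF _ U(2)] vf_lc[OF U(1)]
  have "lie_form A g e X Y p = 0" using killing U X by blast
  then have "e p (pairing g X Y) = g p (lie_bracket A e X p) (Y p) + g p (lie_bracket A e Y p) (X p)"
    using g_commute[OF p, of "X p" "lie_bracket A e Y p"] vf T vf_lie_bracket[OF U(1)]
    by (simp add: lie_form_def act_def pairing_def)
  then show ?thesis
    using lc_metric[OF U vf(3) X] T vf
    by (simp add: lie_bracket_lc[OF U] g_diff_left[OF p])
qed

text \<open>\<open>g((D\<^sub>V c)(X, Y), Z)\<close>, where in the two Leibniz terms invariance has moved the undifferentiated
factor to the other argument of \<open>g\<close>.\<close>

definition dcov :: "'a vfield \<Rightarrow> 'a vfield \<Rightarrow> 'a vfield \<Rightarrow> 'a vfield \<Rightarrow> 'a \<Rightarrow> real" where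
  "dcov V X Y Z p = g p (lc V (mult c X Y) p) (Z p)
     - g p (lc V X p) (c p (Y p) (Z p)) - g p (lc V Y p) (c p (X p) (Z p))"

context
  fixes U :: "'a set" and p :: 'a
  assumes U: "U \<in> opens A" "p \<in> U"
begin

lemmas pM = opensD(1)[OF U]
lemmas tan = vf_tangent[OF _ U(2)]
lemmas vf = vf_unit[OF U(1)] vf_lc[OF U(1)] vf_mult[OF U(1)] vf_lie_bracket[OF U(1)]

lemma c_tan: "X \<in> vfields A U \<Longrightarrow> Y \<in> vfields A U \<Longrightarrow> c p (X p) (Y p) = c p (Y p) (X p)"
  by (intro c_commute pM tan)

lemma mult_commute_on:
  assumes "X \<in> vfields A U" "Y \<in> vfields A U" "q \<in> U"
  shows "mult c X Y q = mult c Y X q"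
  unfolding mult_def
  by (intro c_commute opensD(1)[OF U(1)] vf_tangent[OF _ assms(3)] assms)

lemma act_pairing_cong:
  assumes "V \<in> vfields A U" "\<And>q. q \<in> U \<Longrightarrow> pairing g X Y q = pairing g X' Y' q"
  shows "V p (pairing g X Y) = V p (pairing g X' Y')"
  by (rule tangent_cong[OF tan[OF assms(1)] opensD(2)[OF U(1)] U(2)]) (use assms(2) in simp)

lemma g_lie_bracket:
  assumes "X \<in> vfields A U" "Y \<in> vfields A U" "w \<in> tangent_space A p"
  shows "g p (lie_bracket A X Y p) w = g p (lc X Y p) w - g p (lc Y X p) w"
  unfolding lie_bracket_lc[OF U assms(1,2)] by (intro g_diff_left pM tan vf assms)

lemma dcov_commute12:
  assumes "V \<in> vfields A U" "X \<in> vfields A U" "Y \<in> vfields A U"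
  shows "dcov V X Y Z p = dcov V Y X Z p"
proof -
  have "lc V (mult c X Y) p = lc V (mult c Y X) p"
    by (rule lc_cong[OF U(1) _ _ _ _ _ mult_commute_on U(2)]) (use assms vf in auto)
  then show ?thesis by (simp add: dcov_def)
qed

text \<open>Since \<open>D g = 0\<close>, this is the covariant derivative of the trilinear form \<open>g(X \<circ> Y, Z)\<close>, which is totally
symmetric by invariance. Together with the symmetry in the first two arguments, \<^const>\<open>dcov\<close> is
symmetric in all three.\<close>

lemma dcov_commute23:
  assumes V: "V \<in> vfields A U" "X \<in> vfields A U" "Y \<in> vfields A U" "Z \<in> vfields A U"
  shows "dcov V X Y Z p = dcov V X Z Y p"
proof -
  have eq: "pairing g (mult c X Y) Z q = pairing g (mult c X Z) Y q" if q: "q \<in> U" for q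
    unfolding pairing_def mult_def
    by (simp add: g_invariant[OF opensD(1)[OF U(1) q]] V[THEN vf_tangent[OF _ q]]
        c_commute[OF opensD(1)[OF U(1) q], of "Y q" "Z q"])
  have "g p (lc V (mult c X Y) p) (Z p) + g p (lc V Z p) (c p (X p) (Y p)) =
      g p (lc V (mult c X Z) p) (Y p) + g p (lc V Y p) (c p (X p) (Z p))"
    using lc_metric[OF U V(1) vf(3)[OF V(2,3)] V(4)] lc_metric[OF U V(1) vf(3)[OF V(2,4)] V(3)]
      act_pairing_cong[OF V(1) eq] by (simp add: mult_def)
  then show ?thesis by (simp add: dcov_def c_tan[OF V(3,4)])
qed

text \<open>Differentiating \<open>g(X \<circ> Y, e) = g(X, Y)\<close> shows that the derivative of the product is governed by \<open>\<omega>\<close>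
as soon as one argument is the unit.\<close>

lemma dcov_unit:
  assumes V: "V \<in> vfields A U" "X \<in> vfields A U" "Y \<in> vfields A U"
  shows "dcov V X Y e p = - g p (lc V e p) (c p (X p) (Y p))"
proof -
  have eq: "pairing g (mult c X Y) e q = pairing g X Y q" if q: "q \<in> U" for q
    unfolding pairing_def mult_def
    by (simp add: g_invariant[OF opensD(1)[OF U(1) q]] V[THEN vf_tangent[OF _ q]]
        vf(1)[THEN vf_tangent[OF _ q]] c_unit[OF opensD(1)[OF U(1) q]])
  have "g p (lc V (mult c X Y) p) (e p) + g p (lc V e p) (c p (X p) (Y p)) =
      g p (lc V X p) (Y p) + g p (lc V Y p) (X p)"
    using lc_metric[OF U V(1) vf(3)[OF V(2,3)] vf(1)] lc_metric[OF U V]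
      act_pairing_cong[OF V(1) eq] by (simp add: mult_def)
  then show ?thesis by (simp add: dcov_def c_unit[OF pM] tan V)
qed

lemma lie_product_lc:
  assumes V: "V \<in> vfields A U" "X \<in> vfields A U" "Y \<in> vfields A U" "Z \<in> vfields A U"
  shows "g p (lie_product A c V X Y p) (Z p) =
    dcov V X Y Z p - g p (lc (mult c X Y) V p) (Z p)
      + g p (lc X V p) (c p (Y p) (Z p)) + g p (lc Y V p) (c p (X p) (Z p))"
proof -
  note B = vf(4)
  have "g p (lie_product A c V X Y p) (Z p) = g p (lie_bracket A V (mult c X Y) p) (Z p)
      - g p (c p (lie_bracket A V X p) (Y p)) (Z p) - g p (c p (X p) (lie_bracket A V Y p)) (Z p)"
    by (simp add: lie_product_def mult_apply g_diff_left[OF pM] tangent_diff c_tangent[OF pM]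
        tan V vf)
  also have "g p (c p (lie_bracket A V X p) (Y p)) (Z p) = g p (lie_bracket A V X p) (c p (Y p) (Z p))"
    by (intro g_invariant pM tan V vf)
  also have "g p (c p (X p) (lie_bracket A V Y p)) (Z p) = g p (lie_bracket A V Y p) (c p (X p) (Z p))"
    using c_tan[OF V(2) B[OF V(1,3)]] by (simp add: V vf g_invariant[OF pM] tan)
  finally show ?thesis
    by (simp add: dcov_def g_lie_bracket V vf(3) tan c_tangent[OF pM])
qed

text \<open>The F-manifold identity, written with \<open>D\<close> in place of brackets, is a relation between the values of
\<open>D c\<close> alone, because the derivatives of the vector fields cancel. Paired with \<open>e\<close>, the derivatives along the products
\<open>X \<circ> Y\<close> and \<open>Z \<circ> W\<close> are values of \<open>\<omega>\<close> by \<open>dcov_unit\<close>, and add up to the right-hand side since \<open>\<omega>\<close> is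
antisymmetric; the other terms form the left-hand side.\<close>

lemma hertling_manin_unit:
  assumes V: "X \<in> vfields A U" "Y \<in> vfields A U" "Z \<in> vfields A U" "W \<in> vfields A U"
  shows "dcov X Y Z W p + dcov Y X Z W p - dcov Z X Y W p - dcov W X Y Z p =
    - 2 * g p (lc (mult c X Y) e p) (c p (Z p) (W p))"
proof -
  have hm: "lie_product A c (mult c X Y) Z W p =
      c p (X p) (lie_product A c Y Z W p) + c p (Y p) (lie_product A c X Z W p)"
    by (rule F_manifoldD(5)[OF F U(1) V U(2)])
  have L: "lie_product A c V Z W p \<in> tangent_space A p" if "V \<in> vfields A U" for V
    using that by (simp add: lie_product_def mult_apply tangent_diff c_tangent[OF pM] tan V vf)
  have pull: "g p (c p (X p) (lie_product A c Y Z W p)) (e p) = g p (lie_product A c Y Z W p) (X p)"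
    if "X \<in> vfields A U" "Y \<in> vfields A U" for X Y
    using that by (simp add: c_commute[OF pM tan[OF that(1)] L] g_invariant[OF pM] tan vf L c_unit[OF pM])
  have "g p (lie_product A c (mult c X Y) Z W p) (e p) =
      g p (lie_product A c Y Z W p) (X p) + g p (lie_product A c X Z W p) (Y p)"
    unfolding hm using V by (simp add: g_add_left[OF pM] c_tangent[OF pM] tan L vf pull)
  then have "dcov (mult c X Y) Z W e p - g p (lc (mult c Z W) (mult c X Y) p) (e p)
        + g p (lc Z (mult c X Y) p) (W p) + g p (lc W (mult c X Y) p) (Z p) =
      dcov Y Z W X p - g p (lc (mult c Z W) Y p) (X p)
        + g p (lc Z Y p) (c p (W p) (X p)) + g p (lc W Y p) (c p (Z p) (X p)) +
      (dcov X Z W Y p - g p (lc (mult c Z W) X p) (Y p)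
        + g p (lc Z X p) (c p (W p) (Y p)) + g p (lc W X p) (c p (Z p) (Y p)))"
    by (simp add: lie_product_lc V vf c_unit[OF pM] tan)
  moreover have "dcov (mult c X Y) Z W e p = - g p (lc (mult c X Y) e p) (c p (Z p) (W p))"
    by (intro dcov_unit V vf)
  moreover have "g p (lc (mult c Z W) (mult c X Y) p) (e p) - g p (lc (mult c Z W) X p) (Y p)
      - g p (lc (mult c Z W) Y p) (X p) = g p (lc (mult c X Y) e p) (c p (Z p) (W p))"
  proof -
    have "dcov (mult c Z W) X Y e p = - g p (lc (mult c Z W) e p) (c p (X p) (Y p))"
      by (intro dcov_unit V vf)
    also have "\<dots> = g p (lc (mult c X Y) e p) (c p (Z p) (W p))"
      using unit_killing[OF U vf(3)[OF V(1,2)] vf(3)[OF V(3,4)]] by (simp add: mult_def)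
    finally show ?thesis by (simp add: dcov_def c_unit[OF pM] tan V)
  qed
  moreover have "dcov X Z W Y p = dcov X Y Z W p" "dcov Y Z W X p = dcov Y X Z W p"
    using dcov_commute12[OF V(1,2,3)] dcov_commute23[OF V(1,3,4,2)]
      dcov_commute12[OF V(2,1,3)] dcov_commute23[OF V(2,3,4,1)] by simp_all
  moreover have "dcov Z X Y W p = g p (lc Z (mult c X Y) p) (W p) - g p (lc Z X p) (c p (W p) (Y p))
      - g p (lc Z Y p) (c p (W p) (X p))"
    "dcov W X Y Z p = g p (lc W (mult c X Y) p) (Z p) - g p (lc W X p) (c p (Z p) (Y p))
      - g p (lc W Y p) (c p (Z p) (X p))"
    by (simp_all add: dcov_def c_tan[OF V(2,4)] c_tan[OF V(1,4)] c_tan[OF V(2,3)] c_tan[OF V(1,3)])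
  ultimately show ?thesis by linarith
qed

text \<open>Fix four fields and write \<open>P\<^sub>X\<close> for the derivative of the product along \<open>X\<close> in the direction of the other
three. The preceding lemma gives \<open>P\<^sub>X + P\<^sub>Y - P\<^sub>Z - P\<^sub>W = - 2 \<omega>(X \<circ> Y, Z \<circ> W)\<close>. Adding the two instances with
\<open>Y\<close> exchanged for \<open>Z\<close> and for \<open>W\<close> leaves \<open>2 (P\<^sub>X - P\<^sub>Y)\<close>. In terms of the associated connection
\<open>\<nabla>\<^sub>X Y = D\<^sub>X Y - D\<^sub>X\<^sub>\<circ>\<^sub>Y e\<close> this is the symmetry of \<open>\<nabla> c\<close>.\<close>

lemma dcov_antisymmetrized:
  assumes V: "X \<in> vfields A U" "Y \<in> vfields A U" "Z \<in> vfields A U" "W \<in> vfields A U"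
  shows "dcov X Y Z W p - dcov Y X Z W p =
    g p (lc (mult c Y Z) e p) (c p (X p) (W p)) - g p (lc (mult c X Z) e p) (c p (Y p) (W p))"
proof -
  have "g p (lc (mult c X W) e p) (c p (Y p) (Z p)) = - g p (lc (mult c Y Z) e p) (c p (X p) (W p))"
    using unit_killing[OF U vf(3)[OF V(1,4)] vf(3)[OF V(2,3)]] by (simp add: mult_def)
  moreover note hertling_manin_unit[OF V(1,3,2,4)] hertling_manin_unit[OF V(1,4,2,3)]
  moreover have "dcov X Z Y W p = dcov X Y Z W p" "dcov X W Y Z p = dcov X Y Z W p"
    "dcov Y X W Z p = dcov Y X Z W p" "dcov Z X W Y p = dcov Z X Y W p"
    "dcov W X Z Y p = dcov W X Y Z p"
    using dcov_commute12[OF V(1,2,3)] dcov_commute12[OF V(1,2,4)] dcov_commute23[OF V]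
      dcov_commute23[OF V(2,1,3,4)] dcov_commute23[OF V(3,1,2,4)] dcov_commute23[OF V(4,1,2,3)]
    by simp_all
  ultimately show ?thesis by linarith
qed

text \<open>For the dual \<open>\<theta> = g(e, \<cdot>)\<close> of a Killing field, \<open>d\<theta> = 2 \<omega>\<close>.\<close>

lemma ext_deriv_counit:
  assumes V: "X \<in> vfields A U" "Y \<in> vfields A U"
  shows "ext_deriv A (\<lambda>q. g q (e q)) X Y p = 2 * g p (lc X e p) (Y p)"
proof -
  have "ext_deriv A (\<lambda>q. g q (e q)) X Y p =
      X p (pairing g e Y) - Y p (pairing g e X) - g p (e p) (lie_bracket A X Y p)"
    by (simp add: ext_deriv_def act_def pairing_def)
  also have "g p (e p) (lie_bracket A X Y p) = g p (lc X Y p) (e p) - g p (lc Y X p) (e p)"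
    using g_commute[OF pM tan[OF vf(1)] tan[OF vf(4)[OF V]]] V
    by (simp add: lie_bracket_lc[OF U] g_diff_left[OF pM] tan vf)
  finally show ?thesis
    using unit_killing[OF U V] by (simp add: lc_metric[OF U] V vf)
qed

end

text \<open>The difference \<open>N = D - \<nabla>\<close> is symmetric, both connections being torsionless, and the defining
equation of \<open>\<nabla>\<close> reads \<open>g(N(X, Y), Z) + g(N(X, Z), Y) = \<omega>(X \<circ> Y, Z) + \<omega>(X \<circ> Z, Y)\<close>. The cyclic
combination known from the Koszul formula then gives \<open>g(N(X, Y), Z) = \<omega>(X \<circ> Y, Z)\<close>.\<close>

lemma lc_eq_associated:
  assumes nabla: "associated_connection A c g e nabla"
    and U: "U \<in> opens A" "p \<in> U" and X: "X \<in> vfields A U" "Y \<in> vfields A U"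
  shows "lc X Y p = nabla X Y p + lc (mult c X Y) e p"
proof (rule g_nondegenerate[OF pM[OF U]])
  have vf_nabla: "nabla X Y \<in> vfields A V"
    if "V \<in> opens A" "X \<in> vfields A V" "Y \<in> vfields A V" for V X Y
    using nabla that unfolding associated_connection_def by (blast dest: is_connectionD(1))
  show "lc X Y p \<in> tangent_space A p" "nabla X Y p + lc (mult c X Y) e p \<in> tangent_space A p"
    by ((rule tangent_add)?; intro vf_tangent[OF _ U(2)] vf_nabla vf[OF U] U(1) X)+
  fix w assume "w \<in> tangent_space A p"
  then obtain V W where V: "V \<in> opens A" "V \<subseteq> U" "p \<in> V" "W \<in> vfields A V" "W p = w"
    using tangent_extends[OF U] by metis
  have X': "X \<in> vfields A V" "Y \<in> vfields A V"
    using X V by (auto intro: vfields_subset)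
  let ?n = "\<lambda>X Y Z. g p (lc X Y p) (Z p) - g p (nabla X Y p) (Z p)"
  let ?w = "\<lambda>X Y. g p (lc X e p) (Y p)"
  note vfV = vf[OF V(1,3)] vf_nabla[OF V(1)] and tanV = tan[OF V(1,3)] and p = pM[OF V(1,3)]
  have n: "?n X Y Z + ?n X Z Y = ?w (mult c X Y) Z + ?w (mult c X Z) Y"
    if Z: "X \<in> vfields A V" "Y \<in> vfields A V" "Z \<in> vfields A V" for X Y Z
  proof -
    have "cov_deriv_form nabla g X Y Z p = 1/2 * ext_deriv A (\<lambda>p. g p (e p)) (mult c X Y) Z p
        + 1/2 * ext_deriv A (\<lambda>p. g p (e p)) (mult c X Z) Y p"
      using nabla V Z unfolding associated_connection_def Let_def by blast
    then have "X p (pairing g Y Z) - g p (nabla X Y p) (Z p) - g p (Y p) (nabla X Z p) =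
        ?w (mult c X Y) Z + ?w (mult c X Z) Y"
      using Z vfV by (simp add: ext_deriv_counit[OF V(1,3)] cov_deriv_form_def act_def pairing_def)
    moreover have "g p (Y p) (nabla X Z p) = g p (nabla X Z p) (Y p)"
      by (intro g_commute p tanV vfV Z)
    ultimately show ?thesis using lc_metric[OF V(1,3) Z] by simp
  qed
  have sym: "?n X Y Z = ?n Y X Z"
    if Z: "X \<in> vfields A V" "Y \<in> vfields A V" "Z \<in> vfields A V" for X Y Z
  proof -
    have "(nabla X Y - nabla Y X) p = lie_bracket A X Y p"
      using nabla V Z unfolding associated_connection_def torsionless_def by blast
    then have "nabla X Y p - nabla Y X p = lc X Y p - lc Y X p"
      by (simp add: lie_bracket_lc[OF V(1,3)] Z)
    then have "g p (nabla X Y p - nabla Y X p) (Z p) = g p (lc X Y p - lc Y X p) (Z p)" by simp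
    then show ?thesis using Z by (simp add: g_diff_left[OF p] tanV vfV)
  qed
  have wsym: "?w (mult c X Y) Z = ?w (mult c Y X) Z"
    if Z: "X \<in> vfields A V" "Y \<in> vfields A V" for X Y Z
    using lc_cong[OF V(1) _ _ _ _ mult_commute_on[OF V(1,3) Z] _ V(3)] Z vfV by simp
  have "?n X Y W = ?w (mult c X Y) W"
    using n[OF X' V(4)] n[OF X'(2,1) V(4)] n[OF V(4) X'] sym[OF X' V(4)] sym[OF X'(1) V(4) X'(2)]
      sym[OF X'(2) V(4) X'(1)] wsym[OF X'] wsym[OF X'(1) V(4)] wsym[OF X'(2) V(4)]
    by (smt (verit))
  then show "g p (lc X Y p) w = g p (nabla X Y p + lc (mult c X Y) e p) w"
    using V X' by (auto simp: g_add_left[OF p] tanV vfV)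
qed

text \<open>The hypothesis on \<open>K\<close> is \<open>\<nabla> K = 0\<close>. Paired with a test field \<open>W\<close>, the left-hand side contains the
antisymmetrised derivative of the product, which equals \<open>\<omega>(Z \<circ> K, Y \<circ> W) - \<omega>(Y \<circ> K, Z \<circ> W)\<close>, and
the derivatives of \<open>K\<close>, which contribute exactly the opposite. What remains is
\<open>K \<circ> (D\<^sub>Y Z - D\<^sub>Z Y)\<close>.\<close>

lemma legendre_torsion:
  assumes U: "U \<in> opens A" "p \<in> U" and V: "Y \<in> vfields A U" "Z \<in> vfields A U" and K: "K \<in> vfields A U"
    and flat: "\<And>Y. Y \<in> vfields A U \<Longrightarrow> lc Y K p = lc (mult c Y K) e p"
  shows "lc Y (mult c K Z) p - lc Z (mult c K Y) p = c p (K p) (lie_bracket A Y Z p)"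
proof (rule g_nondegenerate[OF pM[OF U]])
  note vfU = vf[OF U] and tanU = tan[OF U]
  show "lc Y (mult c K Z) p - lc Z (mult c K Y) p \<in> tangent_space A p"
    "c p (K p) (lie_bracket A Y Z p) \<in> tangent_space A p"
    by (intro tangent_diff c_tangent pM[OF U] tanU vfU V K)+
  fix w assume "w \<in> tangent_space A p"
  then obtain S W where S: "S \<in> opens A" "S \<subseteq> U" "p \<in> S" "W \<in> vfields A S" "W p = w"
    using tangent_extends[OF U] by metis
  have V': "Y \<in> vfields A S" "Z \<in> vfields A S" "K \<in> vfields A S"
    using V K S by (auto intro: vfields_subset)
  note vfS = vf[OF S(1,3)] and tanS = tan[OF S(1,3)] and p = pM[OF S(1,3)]
  have "dcov Y K Z W p - dcov Z K Y W p =
      g p (lc Z K p) (c p (Y p) (W p)) - g p (lc Y K p) (c p (Z p) (W p))"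
    using dcov_antisymmetrized[OF S(1,3) V'(1,2,3) S(4)]
      dcov_commute12[OF S(1,3) V'(1,2,3)] dcov_commute12[OF S(1,3) V'(2,1,3)]
    by (simp add: flat V)
  then have "g p (lc Y (mult c K Z) p) (W p) - g p (lc Z (mult c K Y) p) (W p) =
      g p (lc Y Z p) (c p (K p) (W p)) - g p (lc Z Y p) (c p (K p) (W p))"
    by (simp add: dcov_def)
  also have "\<dots> = g p (lie_bracket A Y Z p) (c p (K p) (W p))"
    by (simp add: lie_bracket_lc[OF U] V g_diff_left[OF p] tanU vfU c_tangent[OF p] K tanS S(4))
  also have "\<dots> = g p (c p (K p) (lie_bracket A Y Z p)) (W p)"
    using c_commute[OF p tanU[OF K] tanU[OF vfU(4)[OF V]]]
    by (simp add: g_invariant[OF p] tanU vfU V K tanS S(4))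
  finally show "g p (lc Y (mult c K Z) p - lc Z (mult c K Y) p) w = g p (c p (K p) (lie_bracket A Y Z p)) w"
    using S(5) tanS[OF S(4)] by (auto simp: g_diff_left[OF p] tanU vfU V K)
qed

text \<open>The F-manifold identity for \<open>X = Y = e\<close> reads \<open>\<L>\<^sub>e c = 2 \<L>\<^sub>e c\<close>.\<close>

lemma lie_product_unit:
  assumes U: "U \<in> opens A" "p \<in> U" and V: "Y \<in> vfields A U" "Z \<in> vfields A U"
  shows "lie_product A c e Y Z p = 0"
proof -
  note vfU = vf[OF U] and tanU = tan[OF U] and p = pM[OF U]
  have ee: "mult c e e q = e q" if "q \<in> U" for q
    using c_unit(1)[OF opensD(1)[OF U(1) that] vf_tangent[OF vfU(1) that]] by (simp add: mult_def)
  have L: "lie_product A c e Y Z p \<in> tangent_space A p"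
    by (simp add: lie_product_def mult_apply tangent_diff c_tangent[OF p] tanU V vfU)
  have "lie_bracket A (mult c e e) W p = lie_bracket A e W p" if "W \<in> vfields A U" for W
    using lc_cong[OF U(1) vfU(3)[OF vfU(1,1)] that vfU(1) that ee refl U(2)]
      lc_cong[OF U(1) that vfU(3)[OF vfU(1,1)] that vfU(1) refl ee U(2)] that
    by (simp add: lie_bracket_lc[OF U] vfU)
  then have "lie_product A c (mult c e e) Y Z p = lie_product A c e Y Z p"
    by (simp add: lie_product_def mult_apply V vfU)
  moreover have "lie_product A c (mult c e e) Y Z p =
      c p (e p) (lie_product A c e Y Z p) + c p (e p) (lie_product A c e Y Z p)"
    by (rule F_manifoldD(5)[OF F U(1) vfU(1,1) V U(2)])
  ultimately show ?thesis by (simp add: c_unit[OF p L])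
qed

end

section \<open>The Legendre transform of the metric\<close>

text \<open>\<open>K'\<close> is the inverse of \<open>K\<close>, and the condition on \<open>K\<close> is \<open>\<nabla> K = 0\<close> for the associated connection \<open>\<nabla>\<close>,
expressed through \<open>D\<close>.\<close>

locale legendre_flat = riemannian_F_calculus A c g e lc
  for A :: "('a::{t2_space,second_countable_topology}, 'b::euclidean_space) chart set"
    and c g e lc +
  fixes K K' :: "'a vfield"
  assumes K: "K \<in> vfields A (mcarrier A)" and K': "K' \<in> vfields A (mcarrier A)"
    and inverse: "\<And>p. p \<in> mcarrier A \<Longrightarrow> mult c K K' p = e p"
    and flat: "\<And>U Y p. U \<in> opens A \<Longrightarrow> Y \<in> vfields A U \<Longrightarrow> p \<in> U \<Longrightarrow> lc Y K p = lc (mult c Y K) e p"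
begin

definition legendre_metric :: "'a bilinear_form" where
  "legendre_metric p v w = g p (c p (K p) v) (c p (K p) w)"

text \<open>The connection \<open>D\<close> conjugated by multiplication with \<open>K\<close>. That multiplication is by definition an
isometry from the new metric to \<open>g\<close>, so the conjugate connection is metric for the new one.\<close>

definition legendre_lc :: "'a connection" where
  "legendre_lc Y Z = mult c K' (lc Y (mult c K Z))"

lemmas vf_K = vfields_global[OF K] and vf_K' = vfields_global[OF K']
lemmas tangent_K = vf_tangent[OF K] and tangent_K' = vf_tangent[OF K']

lemma pairing_legendre_metric:
  "pairing legendre_metric Y Z = pairing g (mult c K Y) (mult c K Z)"
  by (simp add: pairing_def legendre_metric_def mult_def)

lemma K_cancel:
  assumes "p \<in> mcarrier A" "u \<in> tangent_space A p"
  shows "c p (K p) (c p (K' p) u) = u" "c p (K' p) (c p (K p) u) = u"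
proof -
  note T = tangent_K[OF assms(1)] tangent_K'[OF assms(1)] assms(2)
  have "c p (K p) (K' p) = e p" using inverse[OF assms(1)] by (simp add: mult_def)
  then show "c p (K p) (c p (K' p) u) = u" "c p (K' p) (c p (K p) u) = u"
    using c_assoc[OF assms(1) T] c_assoc[OF assms(1) T(2,1,3)] c_commute[OF assms(1) T(1,2)]
      c_unit[OF assms(1) T(3)] by simp_all
qed

lemma c_K_mult:
  assumes "p \<in> mcarrier A" "u \<in> tangent_space A p" "v \<in> tangent_space A p"
  shows "c p (K p) (c p u v) = c p u (c p (K p) v)" "c p (K p) (c p u v) = c p (c p (K p) u) v"
  using assms c_assoc[OF assms(1) tangent_K[OF assms(1)] assms(2,3)]
    c_assoc[OF assms(1,2) tangent_K[OF assms(1)] assms(3)]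
    c_commute[OF assms(1,2) tangent_K[OF assms(1)]] by simp_all

lemma legendre_metric_is_metric: "is_metric A legendre_metric"
  unfolding is_metric_def
proof (intro conjI ballI allI impI)
  fix p u v assume p: "p \<in> mcarrier A" and u: "u \<in> tangent_space A p" and v: "v \<in> tangent_space A p"
  note T = tangent_K[OF p] c_tangent[OF p]
  show "legendre_metric p u v = legendre_metric p v u"
    unfolding legendre_metric_def by (intro g_commute p T u v)
  fix w assume "w \<in> tangent_space A p"
  then show "legendre_metric p (u + w) v = legendre_metric p u v + legendre_metric p w v"
    unfolding legendre_metric_def using u v T by (simp add: c_add_right[OF p] g_add_left[OF p])
next
  fix p u v a assume p: "p \<in> mcarrier A" and u: "u \<in> tangent_space A p" and v: "v \<in> tangent_space A p"
  then show "legendre_metric p (tscale a u) v = a * legendre_metric p u v"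
    unfolding legendre_metric_def
    by (simp add: c_scale_right[OF p] g_scale_left[OF p] c_tangent[OF p] tangent_K)
next
  fix p u assume p: "p \<in> mcarrier A" and u: "u \<in> tangent_space A p"
    and z: "\<forall>v\<in>tangent_space A p. legendre_metric p u v = 0"
  have "g p (c p (K p) u) v = 0" if v: "v \<in> tangent_space A p" for v
    using z[rule_format, OF c_tangent[OF p tangent_K'[OF p] v]] K_cancel(1)[OF p v]
    by (simp add: legendre_metric_def)
  \<comment> \<open>every tangent vector is of the form \<open>K \<circ> w\<close>, so \<open>g\<close> itself detects \<open>K \<circ> u\<close>\<close>
  then have "c p (K p) u = 0"
    by (intro is_metricD(4)[OF metric p] c_tangent[OF p] tangent_K p u)
  then have "c p (K p) u = c p (K p) 0"
    using c_diff_right[OF p tangent_K[OF p] tangent_zero tangent_zero] by simp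
  then show "u = 0" using K_cancel(2)[OF p u] K_cancel(2)[OF p tangent_zero] by simp
next
  fix U X Y assume U: "U \<in> opens A" and "X \<in> vfields A U" "Y \<in> vfields A U"
  then show "smooth_fun A U (pairing legendre_metric X Y)"
    unfolding pairing_legendre_metric
    by (intro is_metricD(5)[OF metric U] vf_mult vf_K)
qed

lemma legendre_metric_invariant:
  assumes U: "U \<in> opens A" "p \<in> U" and X: "X \<in> vfields A U" "Y \<in> vfields A U" "Z \<in> vfields A U"
  shows "pairing legendre_metric (mult c X Y) Z p = pairing legendre_metric X (mult c Y Z) p"
proof -
  note p = opensD(1)[OF U]
  note T = vf_tangent[OF _ U(2)] X tangent_K[OF p] c_tangent[OF p]
  have "c p (K p) (c p (X p) (Y p)) = c p (c p (K p) (X p)) (Y p)"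
    by (intro c_K_mult p T)
  moreover have "c p (K p) (c p (Y p) (Z p)) = c p (Y p) (c p (K p) (Z p))"
    by (intro c_K_mult p T)
  ultimately show ?thesis
    by (simp add: pairing_def legendre_metric_def mult_def g_invariant[OF p] T)
qed

lemma vf_legendre_lc:
  "U \<in> opens A \<Longrightarrow> X \<in> vfields A U \<Longrightarrow> Y \<in> vfields A U \<Longrightarrow> legendre_lc X Y \<in> vfields A U"
  unfolding legendre_lc_def by (intro vf_mult vf_lc vf_K vf_K')

lemma legendre_lc_connection: "is_connection A legendre_lc"
  unfolding is_connection_def
proof (intro ballI conjI allI impI)
  fix U X Y assume "U \<in> opens A" "X \<in> vfields A U" "Y \<in> vfields A U"
  then show "legendre_lc X Y \<in> vfields A U" by (rule vf_legendre_lc)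
next
  fix U X X' Y Y' p
  assume U: "U \<in> opens A" and X: "X \<in> vfields A U" "X' \<in> vfields A U" "Y \<in> vfields A U" "Y' \<in> vfields A U"
    and eq: "\<forall>p\<in>U. X p = X' p \<and> Y p = Y' p" and p: "p \<in> U"
  have "lc X (mult c K Y) p = lc X' (mult c K Y') p"
    by (rule lc_cong[OF U]) (use eq p in \<open>auto simp: mult_def intro!: vf_mult[unfolded mult_def] vf_K U X\<close>)
  then show "legendre_lc X Y p = legendre_lc X' Y' p"
    by (simp add: legendre_lc_def mult_apply)
next
  fix U X Y Z p
  assume U: "U \<in> opens A" and X: "X \<in> vfields A U" "Y \<in> vfields A U" "Z \<in> vfields A U" and p: "p \<in> U"
  note pM = opensD(1)[OF U p]
  note V = vf_lc[OF U] vf_mult[OF U] vf_K[OF U] vfields_add X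
  note T = vf_tangent[OF _ p] tangent_K'[OF pM]
  note add = is_connectionD(3)[OF lc_connection U]
  have "lc (X + Y) (mult c K Z) p = lc X (mult c K Z) p + lc Y (mult c K Z) p"
    using add[OF V(5,6) vf_mult[OF U V(3,7)] p] by simp
  then show "legendre_lc (X + Y) Z p = (legendre_lc X Z + legendre_lc Y Z) p"
    by (simp add: legendre_lc_def mult_def[of c K'] c_add_right[OF pM] T V)
  have "lc X (mult c K (Y + Z)) p = lc X (mult c K Y + mult c K Z) p"
  proof (rule lc_cong[OF U _ _ _ _ refl _ p])
    fix q assume q: "q \<in> U"
    show "mult c K (Y + Z) q = (mult c K Y + mult c K Z) q"
      using c_add_right[OF opensD(1)[OF U q] vf_tangent[OF V(3) q] vf_tangent[OF V(6) q] vf_tangent[OF V(7) q]]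
      by (simp add: mult_def)
  qed (intro V)+
  also have "\<dots> = lc X (mult c K Y) p + lc X (mult c K Z) p"
    using add[OF V(5) vf_mult[OF U V(3,6)] vf_mult[OF U V(3,7)] p] by simp
  finally show "legendre_lc X (Y + Z) p = (legendre_lc X Y + legendre_lc X Z) p"
    by (simp add: legendre_lc_def mult_def[of c K'] c_add_right[OF pM] T V)
next
  fix U X Y f p
  assume U: "U \<in> opens A" and X: "X \<in> vfields A U" "Y \<in> vfields A U" and f: "smooth_fun A U f" and p: "p \<in> U"
  note pM = opensD(1)[OF U p]
  note V = vf_lc[OF U] vf_mult[OF U] vf_K[OF U] vfields_fscale[OF _ f] X
  note T = vf_tangent[OF _ p] tangent_K'[OF pM]
  note scale = is_connectionD(4)[OF lc_connection U X(1) vf_mult[OF U V(3) X(2)] f p]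
  show "legendre_lc (fscale f X) Y p = fscale f (legendre_lc X Y) p"
    using scale by (simp add: legendre_lc_def mult_apply fscale_def c_scale_right[OF pM] T V)
  have "lc X (mult c K (fscale f Y)) p = lc X (fscale f (mult c K Y)) p"
  proof (rule lc_cong[OF U _ _ _ _ refl _ p])
    fix q assume q: "q \<in> U"
    show "mult c K (fscale f Y) q = fscale f (mult c K Y) q"
      using c_scale_right[OF opensD(1)[OF U q] vf_tangent[OF V(3) q] vf_tangent[OF V(6) q]]
      by (simp add: mult_def fscale_def)
  qed (intro V)+
  also have "\<dots> = tscale (f p) (lc X (mult c K Y) p) + tscale (act X f p) (mult c K Y p)"
    using scale by (simp add: fscale_def)
  finally show "legendre_lc X (fscale f Y) p = (fscale f (legendre_lc X Y) + fscale (act X f) Y) p"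
    using K_cancel(2)[OF pM T(1)[OF X(2)]]
    by (simp add: legendre_lc_def mult_apply fscale_def c_add_right[OF pM]
        c_scale_right[OF pM] c_tangent[OF pM] tangent_K[OF pM] tangent_scale T V) (simp add: plus_fun_def)
qed

text \<open>Compatibility with the new metric is immediate from the conjugation; the vanishing of the torsion
is the point where \<open>\<nabla> K = 0\<close> is used.\<close>

lemma legendre_lc_levi_civita: "levi_civita A legendre_metric legendre_lc"
  unfolding levi_civita_def torsionless_def
proof (intro conjI ballI legendre_lc_connection)
  fix U X Y p assume U: "U \<in> opens A" and X: "X \<in> vfields A U" "Y \<in> vfields A U" and p: "p \<in> U"
  note pM = opensD(1)[OF U p]
  note V = vf_lc[OF U] vf_mult[OF U] vf_K[OF U] vf_lie_bracket[OF U] X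
  note T = vf_tangent[OF _ p] tangent_K'[OF pM]
  have "(legendre_lc X Y - legendre_lc Y X) p = c p (K' p) (lc X (mult c K Y) p - lc Y (mult c K X) p)"
    by (simp add: legendre_lc_def mult_apply c_diff_right[OF pM] T V)
  also have "\<dots> = lie_bracket A X Y p"
    using legendre_torsion[OF U p X V(3) flat[OF U _ p]] K_cancel(2)[OF pM T(1)[OF V(4)[OF X]]] by simp
  finally show "(legendre_lc X Y - legendre_lc Y X) p = lie_bracket A X Y p" .
next
  fix U X Y Z p
  assume U: "U \<in> opens A" and X: "X \<in> vfields A U" "Y \<in> vfields A U" "Z \<in> vfields A U" and p: "p \<in> U"
  note pM = opensD(1)[OF U p]
  have "cov_deriv_form lc g X (mult c K Y) (mult c K Z) p = 0"
    using lc U X p vf_mult[OF U vf_K[OF U]] unfolding levi_civita_def by blast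
  moreover have "pairing legendre_metric (legendre_lc X Y) Z p = pairing g (lc X (mult c K Y)) (mult c K Z) p"
    "pairing legendre_metric Y (legendre_lc X Z) p = pairing g (mult c K Y) (lc X (mult c K Z)) p"
    using X by (simp_all add: pairing_def legendre_metric_def legendre_lc_def mult_apply
        mult_apply K_cancel[OF pM vf_tangent[OF vf_lc[OF U] p]] vf_mult[OF U] vf_K[OF U])
  ultimately show "cov_deriv_form legendre_lc legendre_metric X Y Z p = 0"
    by (simp add: cov_deriv_form_def pairing_legendre_metric)
qed

text \<open>Conjugate connections have conjugate curvature.\<close>

lemma riemann_legendre_lc:
  assumes U: "U \<in> opens A" "p \<in> U" and X: "X \<in> vfields A U" "Y \<in> vfields A U" "Z \<in> vfields A U"
  shows "riemann A legendre_lc X Y Z p = c p (K' p) (riemann A lc X Y (mult c K Z) p)"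
proof -
  note p = opensD(1)[OF U]
  note V = vf_lc[OF U(1)] vf_mult[OF U(1)] vf_K[OF U(1)] vf_K'[OF U(1)] vf_lie_bracket[OF U(1)]
  note T = vf_tangent[OF _ U(2)] tangent_K'[OF p]
  have "legendre_lc X (legendre_lc Y Z) p = c p (K' p) (lc X (lc Y (mult c K Z)) p)"
    if "X \<in> vfields A U" "Y \<in> vfields A U" for X Y
  proof -
    have VZ: "lc Y (mult c K Z) \<in> vfields A U" by (intro V that X)
    have "mult c K (legendre_lc Y Z) q = lc Y (mult c K Z) q" if q: "q \<in> U" for q
      using K_cancel(1)[OF opensD(1)[OF U(1) q] vf_tangent[OF VZ q]] by (simp add: legendre_lc_def mult_def)
    then have "lc X (mult c K (legendre_lc Y Z)) p = lc X (lc Y (mult c K Z)) p"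
      by (intro lc_cong[OF U(1) _ _ _ _ refl _ U(2)] vf_legendre_lc V that X U)
    then show ?thesis by (simp add: legendre_lc_def mult_apply)
  qed
  then show ?thesis
    by (simp add: riemann_def X c_diff_right[OF p] T V tangent_diff)
      (simp add: legendre_lc_def mult_apply)
qed

text \<open>If the flow of \<open>V\<close> rescales the product, \<open>g\<close> and \<open>K\<close> with weights \<open>m\<close>, \<open>k\<close> and \<open>d\<close>, then it rescales the new
metric, in which the product and \<open>K\<close> both occur twice. The weights are all 0 for the unit field, and
those of homogeneity for the Euler field.\<close>

lemma legendre_metric_lie_form:
  assumes U: "U \<in> opens A" "p \<in> U" and V: "V \<in> vfields A U" and X: "X \<in> vfields A U" "Y \<in> vfields A U"
    and prod: "\<And>Z. Z \<in> vfields A U \<Longrightarrow> lie_product A c V K Z p = tscale m (mult c K Z p)"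
    and form: "\<And>X Y. X \<in> vfields A U \<Longrightarrow> Y \<in> vfields A U \<Longrightarrow> lie_form A g V X Y p = k * pairing g X Y p"
    and brK: "lie_bracket A V K p = tscale d (K p)"
  shows "lie_form A legendre_metric V X Y p = (k + 2 * (m + d)) * pairing legendre_metric X Y p"
proof -
  note p = opensD(1)[OF U]
  note W = vf_mult[OF U(1)] vf_K[OF U(1)] vf_lie_bracket[OF U(1)] V X
  note T = vf_tangent[OF _ U(2)] tangent_K[OF p]
  \<comment> \<open>multiplication by \<open>K\<close> has weight \<open>m + d\<close>\<close>
  have br: "lie_bracket A V (mult c K Z) p = tscale (m + d) (mult c K Z p) + c p (K p) (lie_bracket A V Z p)"
    if Z: "Z \<in> vfields A U" for Z
  proof -
    have "c p (tscale d (K p)) (Z p) = tscale d (c p (K p) (Z p))"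
      using c_commute[OF p tangent_scale[OF T(2)] T(1)[OF Z]] c_scale_right[OF p T(1)[OF Z] T(2)]
        c_commute[OF p T(2) T(1)[OF Z]] by simp
    then have "lie_bracket A V (mult c K Z) p - tscale d (mult c K Z p) - c p (K p) (lie_bracket A V Z p)
        = tscale m (mult c K Z p)"
      using prod[OF Z] brK by (simp add: lie_product_def mult_apply)
    then show ?thesis by (auto simp: fun_eq_iff tscale_def algebra_simps)
  qed
  have pull: "g p (lie_bracket A V (mult c K Z) p) (mult c K Z' p) =
      (m + d) * legendre_metric p (Z p) (Z' p) + legendre_metric p (lie_bracket A V Z p) (Z' p)"
    if "Z \<in> vfields A U" "Z' \<in> vfields A U" for Z Z'
    using that by (simp add: br g_add_left[OF p] g_scale_left[OF p] tangent_scale c_tangent[OF p] T W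
        legendre_metric_def mult_apply)
  have sym: "g p (mult c K X p) (lie_bracket A V (mult c K Y) p) = g p (lie_bracket A V (mult c K Y) p) (mult c K X p)"
    by (intro g_commute p T W)
  have sym': "legendre_metric p u v = legendre_metric p v u"
    if "u \<in> tangent_space A p" "v \<in> tangent_space A p" for u v
    by (rule is_metricD(1)[OF legendre_metric_is_metric p that])
  have "lie_form A g V (mult c K X) (mult c K Y) p = k * pairing g (mult c K X) (mult c K Y) p"
    by (intro form W)
  then have "V p (pairing legendre_metric X Y) = (k + 2 * (m + d)) * legendre_metric p (X p) (Y p)
      + legendre_metric p (lie_bracket A V X p) (Y p) + legendre_metric p (lie_bracket A V Y p) (X p)"
    using pull[OF X] pull[OF X(2,1)] sym sym'[OF T(1)[OF X(1)] T(1)[OF X(2)]]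
    by (simp add: lie_form_def act_def pairing_legendre_metric)
      (simp add: pairing_def legendre_metric_def mult_def algebra_simps)
  then show ?thesis
    using sym'[OF T(1)[OF X(1)] T(1)[OF W(3)[OF V X(2)]]]
    by (simp add: lie_form_def act_def) (simp add: pairing_def)
qed

end

theorem theorem6p7:
  fixes A :: "('a::{t2_space,second_countable_topology}, 'b::euclidean_space) chart set"
    and c :: "'a product" and g :: "'a bilinear_form"
    and e E X :: "'a vfield" and nabla :: "'a connection" and d :: real
  assumes "homogeneous_riemannian_F_manifold A c g e E"
    and "associated_connection A c g e nabla"
    and "legendre_vfield A c e nabla X"
    and "flat_vfield A nabla X"
    and "\<forall>p\<in>mcarrier A. lie_bracket A E X p = tscale d (X p)"
  shows "homogeneous_riemannian_F_manifold A c (\<lambda>p v w. g p (c p (X p) v) (c p (X p) w)) e E"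
proof -
  note H = assms(1)[unfolded homogeneous_riemannian_F_manifold_def]
  note R = H[THEN conjunct1, unfolded riemannian_F_manifold_def]
  note E = H[THEN conjunct2, THEN conjunct1] and Ec = H[THEN conjunct2, THEN conjunct2, THEN conjunct1]
  obtain k where Eg: "\<forall>U\<in>opens A. \<forall>X\<in>vfields A U. \<forall>Y\<in>vfields A U. \<forall>p\<in>U.
      lie_form A g E X Y p = k * pairing g X Y p"
    using H[THEN conjunct2, THEN conjunct2, THEN conjunct2] by blast
  note F = R[THEN conjunct1]
  note R' = R[THEN conjunct2, THEN conjunct2, THEN conjunct2]
  obtain lc where lc: "levi_civita A g lc"
    and curv: "\<forall>U\<in>opens A. \<forall>X\<in>vfields A U. \<forall>Y\<in>vfields A U. \<forall>Z\<in>vfields A U. \<forall>W\<in>vfields A U. \<forall>p\<in>U.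
      (riemann A lc Y Z (mult c X W) + riemann A lc X Y (mult c Z W) + riemann A lc Z X (mult c Y W)) p = 0"
    using R'[THEN conjunct1] by blast
  note killing = R'[THEN conjunct2]
  interpret riemannian_F_calculus A c g e lc
    by (unfold_locales; rule F_manifoldD(1)[OF F] F R[THEN conjunct2, THEN conjunct1]
        R[THEN conjunct2, THEN conjunct2, THEN conjunct1] lc killing)
  obtain X' where X: "X \<in> vfields A (mcarrier A)" "X' \<in> vfields A (mcarrier A)"
    and inv: "\<And>p. p \<in> mcarrier A \<Longrightarrow> mult c X X' p = e p"
    using assms(3) by (auto simp: legendre_vfield_def invertible_vfield_def)
  have flat: "lc Y X p = lc (mult c Y X) e p" if "U \<in> opens A" "Y \<in> vfields A U" "p \<in> U" for U Y p
  proof -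
    have "nabla Y X p = 0" using assms(4) that by (auto simp: flat_vfield_def)
    then show ?thesis
      using lc_eq_associated[OF assms(2) that(1,3,2) vfields_global[OF X(1) that(1)]] by simp
  qed
  interpret legendre_flat A c g e lc X X'
    by unfold_locales (use X inv flat in auto)
  have metric_eq: "(\<lambda>p v w. g p (c p (X p) v) (c p (X p) w)) = legendre_metric"
    by (intro ext) (simp add: legendre_metric_def)
  have "riemannian_F_manifold A c legendre_metric e"
    unfolding riemannian_F_manifold_def
  proof (intro conjI ballI exI[of _ legendre_lc] F legendre_metric_is_metric legendre_lc_levi_civita)
    fix U Y Z W p assume "U \<in> opens A" "Y \<in> vfields A U" "Z \<in> vfields A U" "W \<in> vfields A U" "p \<in> U"
    then show "pairing legendre_metric (mult c Y Z) W p = pairing legendre_metric Y (mult c Z W) p"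
      by (intro legendre_metric_invariant)
  next
    fix U X1 Y Z W p assume U: "U \<in> opens A" and V: "X1 \<in> vfields A U" "Y \<in> vfields A U" "Z \<in> vfields A U"
      "W \<in> vfields A U" and p: "p \<in> U"
    note pM = opensD(1)[OF U p]
    note VV = vf_mult[OF U] vf_K[OF U] vf_lc[OF U] vf_lie_bracket[OF U]
    note T = vf_tangent[OF _ p] tangent_K'[OF pM]
    have vfR: "riemann A lc Y Z W \<in> vfields A U"
      if "Y \<in> vfields A U" "Z \<in> vfields A U" "W \<in> vfields A U" for Y Z W
      unfolding riemann_def by (intro vfields_diff VV that opensD(2)[OF U])
    \<comment> \<open>\<open>X \<circ> (V \<circ> W) = V \<circ> (X \<circ> W)\<close> brings the conjugated curvature into the form of the hypothesis,
      with \<open>X \<circ> W\<close> in place of \<open>W\<close>\<close>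
    have R: "riemann A legendre_lc Y Z (mult c V W) p = c p (X' p) (riemann A lc Y Z (mult c V (mult c X W)) p)"
      if "Y \<in> vfields A U" "Z \<in> vfields A U" "V \<in> vfields A U" for Y Z V
    proof -
      have eq: "mult c X (mult c V W) q = mult c V (mult c X W) q" if q: "q \<in> U" for q
        using c_K_mult(1)[OF opensD(1)[OF U q] vf_tangent[OF \<open>V \<in> vfields A U\<close> q] vf_tangent[OF V(4) q]]
        by (simp add: mult_def)
      have W: "mult c X (mult c V W) \<in> vfields A U" "mult c V (mult c X W) \<in> vfields A U"
        by (intro VV that V)+
      have L: "lc Y' (mult c X (mult c V W)) q = lc Y' (mult c V (mult c X W)) q"
        if "Y' \<in> vfields A U" "q \<in> U" for Y' q
        by (intro lc_cong[OF U _ _ _ _ refl eq] W that)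
      have LL: "lc Z' (lc Y' (mult c X (mult c V W))) p = lc Z' (lc Y' (mult c V (mult c X W))) p"
        if "Y' \<in> vfields A U" "Z' \<in> vfields A U" for Y' Z'
        by (intro lc_cong[OF U _ _ _ _ refl L] W that VV p)
      have "riemann A lc Y Z (mult c X (mult c V W)) p = riemann A lc Y Z (mult c V (mult c X W)) p"
        using that by (simp add: riemann_def LL L VV p)
      then show ?thesis
        using riemann_legendre_lc[OF U p that(1,2) vf_mult[OF U that(3) V(4)]] by simp
    qed
    let ?V = "mult c X W"
    have "riemann A lc Y Z (mult c X1 ?V) p + riemann A lc X1 Y (mult c Z ?V) p + riemann A lc Z X1 (mult c Y ?V) p = 0"
      using curv[rule_format, OF U V(1,2,3) vf_mult[OF U vf_K[OF U] V(4)] p] by simp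
    then have "c p (X' p) (riemann A lc Y Z (mult c X1 ?V) p + riemann A lc X1 Y (mult c Z ?V) p
        + riemann A lc Z X1 (mult c Y ?V) p) = c p (X' p) 0" by simp
    also have "\<dots> = 0"
      using c_diff_right[OF pM tangent_K'[OF pM] tangent_zero tangent_zero] by simp
    finally show "(riemann A legendre_lc Y Z (mult c X1 W) + riemann A legendre_lc X1 Y (mult c Z W)
        + riemann A legendre_lc Z X1 (mult c Y W)) p = 0"
      using V by (simp add: R c_add_right[OF pM] T vfR VV tangent_add)
  next
    fix U Y Z p assume U: "U \<in> opens A" and V: "Y \<in> vfields A U" "Z \<in> vfields A U" and p: "p \<in> U"
    note pM = opensD(1)[OF U p]
    note e = vf_unit[OF U] and K = vf_K[OF U]
    \<comment> \<open>\<open>[e, X] = 0\<close>, because both \<open>e\<close> and \<open>X\<close> are \<open>\<nabla>\<close>-parallel\<close>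
    have "lc e X p = lc X e p"
    proof -
      have "lc (mult c e X) e p = lc X e p"
        by (rule lc_cong[OF U _ _ _ _ _ refl p])
          (use vf_mult[OF U e K] e K c_unit(1)[OF opensD(1)[OF U] vf_tangent[OF K]] in \<open>auto simp: mult_def\<close>)
      then show ?thesis using flat[OF U e p] by simp
    qed
    then have brX: "lie_bracket A e X p = tscale 0 (X p)"
      by (simp add: lie_bracket_lc[OF U p e K]) (simp add: tscale_def fun_eq_iff)
    have "lie_form A legendre_metric e Y Z p = (0 + 2 * (0 + 0)) * pairing legendre_metric Y Z p"
    proof (rule legendre_metric_lie_form[OF U p e V _ _ brX])
      show "lie_product A c e X W p = tscale 0 (mult c X W p)" if "W \<in> vfields A U" for W
        using lie_product_unit[OF U p K that] by (simp add: tscale_def fun_eq_iff)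
      show "lie_form A g e Y Z p = 0 * pairing g Y Z p" if "Y \<in> vfields A U" "Z \<in> vfields A U" for Y Z
        using killing U that p by simp
    qed
    then show "lie_form A legendre_metric e Y Z p = 0" by simp
  qed
  moreover have "lie_form A legendre_metric E Y Z p = (k + 2 * (1 + d)) * pairing legendre_metric Y Z p"
    if "U \<in> opens A" "Y \<in> vfields A U" "Z \<in> vfields A U" "p \<in> U" for U Y Z p
  proof (rule legendre_metric_lie_form[OF that(1,4) vfields_global[OF E that(1)] that(2,3)])
    show "lie_product A c E X W p = tscale 1 (mult c X W p)" if "W \<in> vfields A U" for W
      using Ec[rule_format, OF \<open>U \<in> opens A\<close> vf_K[OF \<open>U \<in> opens A\<close>] that \<open>p \<in> U\<close>] by (simp add: tscale_def)
    show "lie_form A g E Y Z p = k * pairing g Y Z p" if "Y \<in> vfields A U" "Z \<in> vfields A U" for Y Z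
      using Eg \<open>U \<in> opens A\<close> that \<open>p \<in> U\<close> by simp
    show "lie_bracket A E X p = tscale d (X p)"
      using assms(5) opensD(1)[OF that(1,4)] by simp
  qed
  ultimately show ?thesis
    unfolding homogeneous_riemannian_F_manifold_def metric_eq
    by (intro conjI E Ec exI[of _ "k + 2 * (1 + d)"] ballI)
qed

end
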